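(* Let $k$, $m$, and $t$ be positive integers. There exists $n_0$ (depending on $k,m,t$) such that for every $n\ge n_0$ and every connected graph $G$ with $n$ vertices and $n+k-2$ edges, $$r(G,tK_m)=(n-1)(m-1)+t.$$
   Context: All graphs are finite and simple. $K_m$ is the complete graph on $m$ vertices and $tK_m$ is the disjoint union of $t$ copies of $K_m$. For graphs $G$ and $H$, the Ramsey number $r(G,H)$ is the smallest positive integer $N$ such that every red-blue coloring of the edges of the complete graph $K_N$ contains a red subgraph isomorphic to $G$ or a blue subgraph isomorphic to $H$ (subgraphs are not required to be induced). *)

theory Defs
  imports Main "HOL-Library.Ramsey"
begin

datatype 'a sgraph = SGraph (verts: "'a set") (edges: "'a set set")

definition simple_graph :: "'a sgraph \<Rightarrow> bool" where
  "simple_graph G \<longleftrightarrow> finite (verts G) \<and> edges G \<subseteq> [verts G]\<^bsup>2\<^esup>"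

definition connected_graph :: "'a sgraph \<Rightarrow> bool" where
  "connected_graph G \<longleftrightarrow> verts G \<noteq> {} \<and>
     (\<forall>u\<in>verts G. \<forall>v\<in>verts G. (u, v) \<in> {(x, y). {x, y} \<in> edges G}\<^sup>*)"

definition complete_graph :: "nat \<Rightarrow> nat sgraph" where
  "complete_graph m = SGraph {..<m} ([{..<m}]\<^bsup>2\<^esup>)"

definition disjoint_copies :: "nat \<Rightarrow> 'a sgraph \<Rightarrow> (nat \<times> 'a) sgraph" where
  "disjoint_copies t G =
     SGraph ({..<t} \<times> verts G) (\<Union>i<t. (\<lambda>e. Pair i ` e) ` edges G)"

definition subgraph :: "'a sgraph \<Rightarrow> 'a sgraph \<Rightarrow> bool" where
  "subgraph H G \<longleftrightarrow> simple_graph H \<and> verts H \<subseteq> verts G \<and> edges H \<subseteq> edges G"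

definition isomorphic :: "'a sgraph \<Rightarrow> 'b sgraph \<Rightarrow> bool" where
  "isomorphic G H \<longleftrightarrow>
     (\<exists>f. bij_betw f (verts G) (verts H) \<and> edges H = (\<lambda>e. f ` e) ` edges G)"

definition has_copy :: "'a sgraph \<Rightarrow> 'b sgraph \<Rightarrow> bool" where
  "has_copy G H \<longleftrightarrow> (\<exists>S. subgraph S G \<and> isomorphic H S)"

datatype colour = Red | Blue

text \<open>A colouring of the edges of \<open>K\<^sub>N\<close> is a total function on sets of vertices; only its
  values on the edges of \<open>K\<^sub>N\<close> are ever inspected.\<close>

definition colour_graph :: "nat \<Rightarrow> (nat set \<Rightarrow> colour) \<Rightarrow> colour \<Rightarrow> nat sgraph" where
  "colour_graph N c a =
     SGraph (verts (complete_graph N)) {e \<in> edges (complete_graph N). c e = a}"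

definition arrows :: "nat \<Rightarrow> 'a sgraph \<Rightarrow> 'b sgraph \<Rightarrow> bool" where
  "arrows N G H \<longleftrightarrow>
     (\<forall>c. has_copy (colour_graph N c Red) G \<or> has_copy (colour_graph N c Blue) H)"

text \<open>For finite \<open>G\<close> and \<open>H\<close> a suitable \<open>N\<close> exists by Ramsey's theorem, so the least one
  is well defined.\<close>

definition ramsey_number :: "'a sgraph \<Rightarrow> 'b sgraph \<Rightarrow> nat" where
  "ramsey_number G H = (LEAST N. N > 0 \<and> arrows N G H)"

lemma simple_graph_complete_graph: "simple_graph (complete_graph m)"
  by (simp add: simple_graph_def complete_graph_def)

lemma simple_graph_disjoint_copies:
  assumes "simple_graph G"
  shows "simple_graph (disjoint_copies t G)"
proof -
  have "Pair i ` e \<in> [{..<t} \<times> verts G]\<^bsup>2\<^esup>" if "i < t" "e \<in> edges G" for i e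
  proof -
    have "e \<subseteq> verts G" "finite e" "card e = 2"
      using assms that by (auto simp: simple_graph_def nsets_def)
    then show ?thesis
      using that by (auto simp: nsets_def card_image inj_on_def)
  qed
  then show ?thesis
    using assms by (auto simp: simple_graph_def disjoint_copies_def)
qed

end

theory Submission
  imports Defs
begin

text \<open>The lower bound is the standard colouring: cut the vertices into blocks of size \<open>n - 1\<close>, red inside
a block and blue between blocks. A connected red graph stays in one block, and each blue \<open>K\<^sub>m\<close> must
use a vertex of the last, incomplete block, which has fewer than \<open>t\<close> vertices (\<open>not_arrows\<close>).

For the upper bound consider a colouring without a red \<open>G\<close>, where \<open>G\<close> is connected and has at most
\<open>n + k\<close> edges. The proof is an induction on \<open>m\<close> (\<open>packing_if_no_copy\<close>) and has three ingredients.

\<^item> Peeling (\<open>peel\<close>). If a large set \<open>U\<close> has no blue \<open>K\<^bsub>M+1\<^esub>\<close>, then deleting at most \<open>n - 1\<close>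
  vertices of \<open>U\<close> leaves a set without a blue \<open>K\<^sub>M\<close>. Contract edges of \<open>G\<close> one at a time, always a
  leaf edge or an edge inside a long path of vertices of degree 2; as the cyclomatic number of \<open>G\<close> is
  bounded, one of the two exists until the graph has bounded size (\<open>long_thread\<close>), when Ramsey's
  theorem yields a red copy. So at some stage a contracted graph has a red copy while
  the graph before the contraction has none. The vertices of \<open>U\<close> off this copy contain no blue
  \<open>K\<^sub>M\<close>, since otherwise one vertex of that \<open>K\<^sub>M\<close> could be added to the copy: trivially for a
  leaf, and by the rerouting of Bondy and Erdos for a path.

\<^item> A red clique (\<open>large_red_clique\<close>). If there are no \<open>t\<close> disjoint blue \<open>K\<^sub>m\<close>, deleting a maximal
  collection of them costs a bounded number of vertices. Peeling the rest \<open>m - 2\<close> times ends in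
  a red clique \<open>Q\<close> with at least \<open>n - c\<close> vertices, where \<open>c\<close> is bounded.

\<^item> Absorption (\<open>absorb_maximal\<close>). Move vertices outside \<open>Q\<close> that are red to a positive fraction
  of the current \<open>P \<subseteq> Q\<close> into a set \<open>A\<close>, each time shrinking \<open>P\<close> to the red neighbours. If
  \<open>Q \<union> A\<close> reached \<open>n\<close> vertices, it would contain a red \<open>G\<close>, with independent vertices of
  small degree placed on \<open>A\<close> and their neighbours in \<open>P\<close>. So the process stops earlier, and at least
  \<open>(n - 1)(m - 2) + t\<close> vertices outside \<open>Q \<union> A\<close> remain. By induction they contain \<open>t\<close> disjoint blue
  \<open>K\<^bsub>m-1\<^esub>\<close>, and as all their vertices are blue to most of \<open>P\<close>, each of these cliques
  can be extended by its own vertex of \<open>P\<close> (\<open>packing_extend\<close>).\<close>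

section \<open>Embeddings and independent sets\<close>

text \<open>Throughout, a colouring is represented by its set \<open>E\<close> of red edges, so that \<open>clique K E\<close> says that
\<open>K\<close> is a red clique and \<open>indep K E\<close> that it is a blue one.\<close>
definition embedding :: "'a sgraph \<Rightarrow> 'b set set \<Rightarrow> 'b set \<Rightarrow> ('a \<Rightarrow> 'b) \<Rightarrow> bool" where
  "embedding G E U f \<longleftrightarrow> inj_on f (verts G) \<and> f ` verts G \<subseteq> U \<and>
     (\<forall>x y. {x, y} \<in> edges G \<longrightarrow> {f x, f y} \<in> E)"

definition embeds :: "'a sgraph \<Rightarrow> 'b set set \<Rightarrow> 'b set \<Rightarrow> bool" where
  "embeds G E U \<longleftrightarrow> (\<exists>f. embedding G E U f)"

definition indep_free :: "nat \<Rightarrow> 'b set set \<Rightarrow> 'b set \<Rightarrow> bool" where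
  "indep_free m E U \<longleftrightarrow> (\<forall>K\<subseteq>U. card K = m \<longrightarrow> \<not> indep K E)"

lemma simple_graph_edgeE:
  assumes "simple_graph G" "e \<in> edges G"
  obtains x y where "e = {x, y}" "x \<noteq> y" "x \<in> verts G" "y \<in> verts G"
  using assms unfolding simple_graph_def by (meson nsets2_E subsetD)

lemma simple_graph_edgeD:
  assumes "simple_graph G" "{x, y} \<in> edges G"
  shows "x \<noteq> y" "x \<in> verts G" "y \<in> verts G"
proof -
  have "{x, y} \<in> [verts G]\<^bsup>2\<^esup>"
    using assms unfolding simple_graph_def by blast
  then show "x \<noteq> y" "x \<in> verts G" "y \<in> verts G"
    by simp_all
qed

lemma finite_edges:
  assumes "simple_graph G"
  shows "finite (edges G)"
  using assms unfolding simple_graph_def by (metis finite_imp_finite_nsets finite_subset)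

lemma embeds_mono:
  assumes "embeds G E U" "U \<subseteq> U'"
  shows "embeds G E U'"
  using assms unfolding embeds_def embedding_def by (meson order_trans)

lemma indep_freeE:
  assumes "indep_free m E U" "K \<subseteq> U" "m \<le> card K"
  obtains x y where "x \<in> K" "y \<in> K" "x \<noteq> y" "{x, y} \<in> E"
proof -
  obtain L where L: "L \<subseteq> K" "card L = m"
    using assms(3) by (metis obtain_subset_with_card_n)
  then have "\<not> indep L E"
    using assms(1,2) unfolding indep_free_def by blast
  then show ?thesis
    using L that unfolding indep_def by blast
qed

lemma indep_insert:
  assumes "indep K E" "\<And>x. x \<in> K \<Longrightarrow> x \<noteq> v \<Longrightarrow> {v, x} \<notin> E"
  shows "indep (insert v K) E"
  using assms unfolding indep_def by (auto simp: insert_commute)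

lemma embeds_in_clique:
  assumes G: "simple_graph G" and Q: "clique Q E" "finite Q" "card (verts G) \<le> card Q"
  shows "embeds G E Q"
proof -
  have "finite (verts G)"
    using G by (simp add: simple_graph_def)
  then obtain f where f: "f ` verts G \<subseteq> Q" "inj_on f (verts G)"
    using Q card_le_inj by metis
  have "{f x, f y} \<in> E" if "{x, y} \<in> edges G" for x y
  proof -
    note xy = simple_graph_edgeD[OF G that]
    then have "f x \<noteq> f y"
      using f(2) by (auto dest: inj_onD)
    then show ?thesis
      using xy f(1) Q(1) unfolding clique_def by blast
  qed
  then show ?thesis
    using f unfolding embeds_def embedding_def by blast
qed

text \<open>An injection of the vertices that respects edges determines the subgraph that it maps onto, which
reduces copies in a colour class to maps.\<close>
lemma has_copy_colour_graph_iff: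
  assumes G: "simple_graph G"
  shows "has_copy (colour_graph N c a) G \<longleftrightarrow> embeds G {e. c e = a} {..<N}"
proof
  assume "has_copy (colour_graph N c a) G"
  then obtain S f where S: "subgraph S (colour_graph N c a)"
    and f: "bij_betw f (verts G) (verts S)" "edges S = (\<lambda>e. f ` e) ` edges G"
    unfolding has_copy_def isomorphic_def by blast
  have "f ` verts G \<subseteq> {..<N}"
    using f(1) S unfolding bij_betw_def subgraph_def colour_graph_def complete_graph_def by auto
  moreover have "c {f x, f y} = a" if "{x, y} \<in> edges G" for x y
  proof -
    have "f ` {x, y} \<in> edges S"
      using that f(2) by blast
    then show ?thesis
      using S unfolding subgraph_def colour_graph_def by auto
  qed
  ultimately show "embeds G {e. c e = a} {..<N}"
    using f(1) unfolding embeds_def embedding_def bij_betw_def by (intro exI[of _ f]) simp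
next
  assume "embeds G {e. c e = a} {..<N}"
  then obtain f where f: "inj_on f (verts G)" "f ` verts G \<subseteq> {..<N}"
    and c: "\<And>x y. {x, y} \<in> edges G \<Longrightarrow> c {f x, f y} = a"
    unfolding embeds_def embedding_def by auto
  define S where "S = SGraph (f ` verts G) ((\<lambda>e. f ` e) ` edges G)"
  have e: "f ` e \<in> [f ` verts G]\<^bsup>2\<^esup> \<and> c (f ` e) = a" if e: "e \<in> edges G" for e
  proof -
    obtain x y where xy: "e = {x, y}" "x \<noteq> y" "x \<in> verts G" "y \<in> verts G"
      using simple_graph_edgeE[OF G e] .
    then have "f x \<noteq> f y"
      using f(1) by (auto dest: inj_onD)
    then show ?thesis
      using xy c e by simp
  qed
  have "subgraph S (colour_graph N c a)"
    using e f(2) G nsets_mono[OF f(2), of 2]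
    unfolding subgraph_def S_def colour_graph_def complete_graph_def simple_graph_def
    by auto
  moreover have "isomorphic G S"
    using f(1) unfolding isomorphic_def S_def by (auto intro!: exI[of _ f] simp: bij_betw_def)
  ultimately show "has_copy (colour_graph N c a) G"
    unfolding has_copy_def by blast
qed

section \<open>Sparse connected graphs\<close>

definition sparse :: "nat \<Rightarrow> 'a sgraph \<Rightarrow> bool" where
  "sparse k G \<longleftrightarrow> simple_graph G \<and> connected_graph G \<and> card (edges G) \<le> card (verts G) + k"

definition degree :: "'a sgraph \<Rightarrow> 'a \<Rightarrow> nat" where
  "degree G v = card {e \<in> edges G. v \<in> e}"

definition neighbours :: "'a sgraph \<Rightarrow> 'a set \<Rightarrow> 'a set" where
  "neighbours G A = {w. \<exists>v\<in>A. {v, w} \<in> edges G}"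

lemma handshake:
  assumes "simple_graph G"
  shows "(\<Sum>v\<in>verts G. degree G v) = 2 * card (edges G)"
proof -
  have "card {v \<in> verts G. v \<in> e} = 2" if e: "e \<in> edges G" for e
  proof -
    obtain x y where "e = {x, y}" "x \<noteq> y" "x \<in> verts G" "y \<in> verts G"
      using simple_graph_edgeE[OF assms e] .
    then have "{v \<in> verts G. v \<in> e} = {x, y}"
      by blast
    then show ?thesis
      using \<open>x \<noteq> y\<close> by simp
  qed
  moreover have "finite (verts G)"
    using assms by (simp add: simple_graph_def)
  ultimately show ?thesis
    unfolding degree_def using finite_edges[OF assms] by (intro sum_multicount) auto
qed

lemma degree_pos:
  assumes G: "simple_graph G" "connected_graph G" and "2 \<le> card (verts G)" "v \<in> verts G"
  shows "1 \<le> degree G v"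
proof -
  have "finite (verts G)"
    using G by (simp add: simple_graph_def)
  then obtain w where w: "w \<in> verts G" "w \<noteq> v"
    using assms by (metis One_nat_def card_le_Suc0_iff_eq not_less_eq_eq numeral_2_eq_2)
  then have "(v, w) \<in> {(x, y). {x, y} \<in> edges G}\<^sup>*"
    using G assms unfolding connected_graph_def by blast
  then obtain z where "{v, z} \<in> edges G"
    using w(2) by (auto elim: converse_rtranclE)
  then have "{e \<in> edges G. v \<in> e} \<noteq> {}"
    by blast
  then show ?thesis
    unfolding degree_def using finite_edges[OF G(1)]
    by (simp add: Suc_le_eq card_gt_0_iff)
qed

text \<open>The crude factor 2 comes from bounding the neighbours of a vertex by the union of the edges at it,
which spares a bijection between neighbours and incident edges.\<close>
lemma card_neighbours_le:
  assumes G: "simple_graph G" and A: "finite A" "\<And>v. v \<in> A \<Longrightarrow> degree G v \<le> d"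
  shows "finite (neighbours G A)" "card (neighbours G A) \<le> card A * (2 * d)"
proof -
  have N: "neighbours G A \<subseteq> (\<Union>v\<in>A. \<Union>{e \<in> edges G. v \<in> e})"
    unfolding neighbours_def by blast
  have e: "finite e \<and> card e \<le> 2" if "e \<in> edges G" for e
    using that by (elim simple_graph_edgeE[OF G]) simp
  have fin: "finite (\<Union>{e \<in> edges G. v \<in> e})" for v
    using finite_edges[OF G] e by (intro finite_Union) auto
  have "card (\<Union>{e \<in> edges G. v \<in> e}) \<le> 2 * d" if "v \<in> A" for v
  proof -
    have "card (\<Union>{e \<in> edges G. v \<in> e}) \<le> (\<Sum>e\<in>{e \<in> edges G. v \<in> e}. card e)"
      by (rule card_Union_le_sum_card)
    also have "\<dots> \<le> (\<Sum>e\<in>{e \<in> edges G. v \<in> e}. 2)"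
      using e by (intro sum_mono) blast
    also have "\<dots> \<le> 2 * d"
      using A(2)[OF that] by (simp add: degree_def)
    finally show ?thesis .
  qed
  then have "card (\<Union>v\<in>A. \<Union>{e \<in> edges G. v \<in> e}) \<le> card A * (2 * d)"
    using card_UN_le[OF A(1), of "\<lambda>v. \<Union>{e \<in> edges G. v \<in> e}"]
      sum_bounded_above[of A "\<lambda>v. card (\<Union>{e \<in> edges G. v \<in> e})" "2 * d"] by simp
  moreover have "finite (\<Union>v\<in>A. \<Union>{e \<in> edges G. v \<in> e})"
    using fin A(1) by blast
  ultimately show "finite (neighbours G A)" "card (neighbours G A) \<le> card A * (2 * d)"
    using N by (auto intro: finite_subset dest: card_mono[rotated])
qed

lemma neighbours_subset:
  assumes "simple_graph G"
  shows "neighbours G A \<subseteq> verts G"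
  using simple_graph_edgeD[OF assms] unfolding neighbours_def by blast

subsection \<open>Contracting an edge\<close>

text \<open>The vertex \<open>u\<close> is merged into its neighbour \<open>w\<close>. For a leaf \<open>u\<close> this deletes \<open>u\<close>; for a vertex of
degree 2 with non-adjacent neighbours it replaces a path of length two by an edge.\<close>
definition contract :: "'a sgraph \<Rightarrow> 'a \<Rightarrow> 'a \<Rightarrow> 'a sgraph" where
  "contract G u w = SGraph (verts G - {u})
     ((\<lambda>e. (\<lambda>x. if x = u then w else x) ` e) ` (edges G - {{u, w}}))"

lemma contract_edgeI:
  assumes "{x, y} \<in> edges G" "{x, y} \<noteq> {u, w}"
  shows "{if x = u then w else x, if y = u then w else y} \<in> edges (contract G u w)"
proof -
  have "(\<lambda>x. if x = u then w else x) ` {x, y} \<in> edges (contract G u w)"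
    unfolding contract_def sgraph.sel using assms by blast
  then show ?thesis
    by (simp only: image_insert image_empty)
qed

text \<open>The contracted edge itself disappears, so the edge count drops by at least one together with the
vertex count; parallel edges that get identified only help. A walk is mapped
to a walk, hence connectivity survives.\<close>
lemma contract_sparse:
  assumes G: "sparse k G" and uw: "{u, w} \<in> edges G"
  shows "sparse k (contract G u w)" "card (verts G) = Suc (card (verts (contract G u w)))"
proof -
  let ?p = "\<lambda>x. if x = u then w else x"
  have simple: "simple_graph G" and conn: "connected_graph G"
    using G by (auto simp: sparse_def)
  then have fin: "finite (verts G)" "finite (edges G)"
    using finite_edges by (auto simp: simple_graph_def)
  note uw' = simple_graph_edgeD[OF simple uw]
  show card_V: "card (verts G) = Suc (card (verts (contract G u w)))"
    using card_Suc_Diff1[OF fin(1) uw'(2)] by (simp add: contract_def)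
  have "card (edges (contract G u w)) \<le> card (edges G - {{u, w}})"
    unfolding contract_def using fin by (simp add: card_image_le)
  also have "\<dots> = card (edges G) - 1"
    using uw fin by simp
  finally have card_E: "card (edges (contract G u w)) \<le> card (edges G) - 1" .
  have "?p ` e \<in> [verts G - {u}]\<^bsup>2\<^esup>" if e: "e \<in> edges G" "e \<noteq> {u, w}" for e
  proof -
    obtain x y where xy: "e = {x, y}" "x \<noteq> y" "x \<in> verts G" "y \<in> verts G"
      using simple_graph_edgeE[OF simple e(1)] .
    then have "?p x \<noteq> ?p y"
      using e(2) by (auto simp: insert_commute)
    then have "{?p x, ?p y} \<in> [verts G - {u}]\<^bsup>2\<^esup>"
      using xy uw' by (simp only: doubleton_in_nsets_2) simp
    then show ?thesis
      unfolding xy(1) by (simp only: image_insert image_empty)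
  qed
  then have simple': "simple_graph (contract G u w)"
    using fin unfolding simple_graph_def contract_def by auto
  let ?R = "{(x, y). {x, y} \<in> edges G}" and ?R' = "{(x, y). {x, y} \<in> edges (contract G u w)}"
  have walk: "(?p x, ?p y) \<in> ?R'\<^sup>*" if "(x, y) \<in> ?R\<^sup>*" for x y
    using that
  proof (induction rule: rtrancl_induct)
    case (step y z)
    have "(?p y, ?p z) \<in> ?R'\<^sup>*"
    proof (cases "{y, z} = {u, w}")
      case True
      then have "?p y = ?p z"
        by (auto simp: doubleton_eq_iff)
      then show ?thesis
        by simp
    next
      case False
      then show ?thesis
        using contract_edgeI[of y z G u w] step(2) by (intro r_into_rtrancl) blast
    qed
    then show ?case
      using step.IH by (rule rtrancl_trans[rotated])
  qed simp
  have "connected_graph (contract G u w)"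
    unfolding connected_graph_def
  proof (intro conjI ballI)
    show "verts (contract G u w) \<noteq> {}"
      using uw' by (auto simp: contract_def)
    fix x y
    assume "x \<in> verts (contract G u w)" "y \<in> verts (contract G u w)"
    then have xy: "x \<in> verts G" "x \<noteq> u" "y \<in> verts G" "y \<noteq> u"
      by (auto simp: contract_def)
    then have "(x, y) \<in> ?R\<^sup>*"
      using conn unfolding connected_graph_def by blast
    from walk[OF this] show "(x, y) \<in> ?R'\<^sup>*"
      using xy by simp
  qed
  then show "sparse k (contract G u w)"
    using simple' G card_E card_V unfolding sparse_def by linarith
qed

subsection \<open>Long threads in graphs without leaves\<close>

text \<open>With all degrees at least 2, the degree sum \<open>2 * card (edges G)\<close> exceeds \<open>2 * card (verts G)\<close> by at
most \<open>2 * k\<close>, and every degree above 2 is paid for by this excess.\<close>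
lemma degree_excess:
  assumes G: "sparse k G" and deg: "\<And>v. v \<in> verts G \<Longrightarrow> 2 \<le> degree G v"
  shows "card {v \<in> verts G. 3 \<le> degree G v} \<le> 2 * k"
    and "v \<in> verts G \<Longrightarrow> degree G v \<le> 2 * k + 2"
proof -
  have simple: "simple_graph G"
    using G by (simp add: sparse_def)
  then have fin: "finite (verts G)"
    by (simp add: simple_graph_def)
  have "(\<Sum>v\<in>verts G. degree G v) = (\<Sum>v\<in>verts G. (degree G v - 2) + 2)"
    using deg by (intro sum.cong) (simp_all del: add_2_eq_Suc')
  also have "\<dots> = (\<Sum>v\<in>verts G. degree G v - 2) + 2 * card (verts G)"
    by (subst sum.distrib) simp
  finally have excess: "(\<Sum>v\<in>verts G. degree G v - 2) \<le> 2 * k"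
    using handshake[OF simple] G unfolding sparse_def by linarith
  have "card {v \<in> verts G. 3 \<le> degree G v} = (\<Sum>v\<in>{v \<in> verts G. 3 \<le> degree G v}. 1)"
    by simp
  also have "\<dots> \<le> (\<Sum>v\<in>{v \<in> verts G. 3 \<le> degree G v}. degree G v - 2)"
    by (intro sum_mono) auto
  also have "\<dots> \<le> (\<Sum>v\<in>verts G. degree G v - 2)"
    using fin by (intro sum_mono2) auto
  finally show "card {v \<in> verts G. 3 \<le> degree G v} \<le> 2 * k"
    using excess by linarith
  assume "v \<in> verts G"
  then have "degree G v - 2 \<le> (\<Sum>v\<in>verts G. degree G v - 2)"
    using fin by (intro member_le_sum) auto
  then show "degree G v \<le> 2 * k + 2"
    using excess by linarith
qed

text \<open>A suspended path, except that its two ends are also required to have degree 2; this makes the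
indices uniform.\<close>
definition thread :: "'a sgraph \<Rightarrow> nat \<Rightarrow> (nat \<Rightarrow> 'a) \<Rightarrow> bool" where
  "thread G p y \<longleftrightarrow> inj_on y {..p} \<and> y ` {..p} \<subseteq> verts G \<and>
     (\<forall>i<p. {y i, y (Suc i)} \<in> edges G) \<and> (\<forall>i\<le>p. degree G (y i) = 2)"

primrec ball :: "'a sgraph \<Rightarrow> 'a set \<Rightarrow> nat \<Rightarrow> 'a set" where
  "ball G H 0 = H"
| "ball G H (Suc i) = ball G H i \<union> neighbours G (ball G H i)"

lemma ball_mono: "i \<le> j \<Longrightarrow> ball G H i \<subseteq> ball G H j"
  by (induction j) (auto simp: le_Suc_eq)

lemma card_ball_le:
  assumes G: "simple_graph G" and H: "H \<subseteq> verts G" and deg: "\<And>v. v \<in> verts G \<Longrightarrow> degree G v \<le> d"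
  shows "card (ball G H i) \<le> card H * (2 * d + 1) ^ i" "ball G H i \<subseteq> verts G"
proof (induction i)
  case (Suc i)
  have "finite (ball G H i)"
    using Suc(2) G finite_subset by (auto simp: simple_graph_def)
  then have "card (neighbours G (ball G H i)) \<le> card (ball G H i) * (2 * d)"
    using Suc(2) deg card_neighbours_le(2)[OF G] by (meson subsetD)
  moreover have "card (ball G H (Suc i)) \<le> card (ball G H i) + card (neighbours G (ball G H i))"
    by (simp add: card_Un_le)
  ultimately have "card (ball G H (Suc i)) \<le> card (ball G H i) * (2 * d + 1)"
    by (simp add: algebra_simps)
  also have "\<dots> \<le> card H * (2 * d + 1) ^ i * (2 * d + 1)"
    using Suc(1) by (rule mult_right_mono) simp
  finally show "card (ball G H (Suc i)) \<le> card H * (2 * d + 1) ^ Suc i"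
    by (simp add: algebra_simps)
  show "ball G H (Suc i) \<subseteq> verts G"
    using Suc(2) neighbours_subset[OF G] by simp
qed (use H in auto)

text \<open>A vertex at distance \<open>l\<close> from \<open>H\<close> is joined to \<open>H\<close> by a path whose vertex number \<open>i\<close> is at distance
exactly \<open>i\<close>; the distances show that the vertices are distinct.\<close>
lemma geodesic:
  assumes "v \<in> ball G H l" "\<And>i. i < l \<Longrightarrow> v \<notin> ball G H i"
  shows "\<exists>f. f l = v \<and> (\<forall>i\<le>l. f i \<in> ball G H i \<and> (\<forall>j<i. f i \<notin> ball G H j)) \<and>
    (\<forall>i<l. {f i, f (Suc i)} \<in> edges G)"
  using assms
proof (induction l arbitrary: v)
  case 0
  then show ?case
    by (intro exI[of _ "\<lambda>_. v"]) auto
next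
  case (Suc l)
  then have "v \<in> neighbours G (ball G H l)"
    by auto
  then obtain w where w: "w \<in> ball G H l" "{w, v} \<in> edges G"
    unfolding neighbours_def by blast
  have "w \<notin> ball G H j" if "j < l" for j
  proof
    assume "w \<in> ball G H j"
    then have "v \<in> ball G H (Suc j)"
      using w(2) by (auto simp: neighbours_def)
    then show False
      using Suc.prems(2)[of "Suc j"] that by blast
  qed
  then obtain f where f: "f l = w" "\<forall>i\<le>l. f i \<in> ball G H i \<and> (\<forall>j<i. f i \<notin> ball G H j)"
    "\<forall>i<l. {f i, f (Suc i)} \<in> edges G"
    using Suc.IH w(1) by blast
  show ?case
    using f w(2) Suc.prems by (intro exI[of _ "f(Suc l := v)"]) (auto simp: le_Suc_eq less_Suc_eq)
qed

text \<open>Let \<open>H\<close> consist of the boundedly many vertices of degree at least 3 and one arbitrary vertex, which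
keeps \<open>H\<close> nonempty when \<open>G\<close> is a cycle. Degrees are bounded, so a large graph is not exhausted by
the ball of radius \<open>p + 1\<close> around \<open>H\<close>. A shortest path from a vertex outside
this ball to \<open>H\<close> avoids \<open>H\<close> except at its end, so it runs through more than \<open>p\<close> vertices of degree 2.\<close>
lemma long_thread:
  fixes k p :: nat
  shows "\<exists>S. \<forall>G :: 'a sgraph. sparse k G \<longrightarrow> S \<le> card (verts G) \<longrightarrow> (\<forall>v\<in>verts G. degree G v \<noteq> 1) \<longrightarrow>
     (\<exists>y. thread G p y)"
proof (rule exI[of _ "(2 * k + 1) * (2 * (2 * k + 2) + 1) ^ Suc p + 2"], intro allI impI)
  fix G :: "'a sgraph"
  let ?d = "2 * k + 2"
  assume G: "sparse k G" and size: "(2 * k + 1) * (2 * ?d + 1) ^ Suc p + 2 \<le> card (verts G)"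
    and noleaf: "\<forall>v\<in>verts G. degree G v \<noteq> 1"
  have simple: "simple_graph G" and conn: "connected_graph G"
    using G by (auto simp: sparse_def)
  have fin: "finite (verts G)"
    using simple by (simp add: simple_graph_def)
  have deg2: "2 \<le> degree G v" if "v \<in> verts G" for v
    using degree_pos[OF simple conn _ that] noleaf that size by fastforce
  note excess = degree_excess[OF G deg2]
  obtain v0 where v0: "v0 \<in> verts G"
    using conn unfolding connected_graph_def by blast
  define H where "H = insert v0 {v \<in> verts G. 3 \<le> degree G v}"
  have H: "H \<subseteq> verts G" "v0 \<in> H"
    using v0 by (auto simp: H_def)
  have "card H \<le> Suc (card {v \<in> verts G. 3 \<le> degree G v})"
    unfolding H_def by (rule card_insert_le_m1) auto
  then have cardH: "card H \<le> 2 * k + 1"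
    using excess(1) by linarith
  have "card (ball G H (Suc p)) \<le> card H * (2 * ?d + 1) ^ Suc p"
    using card_ball_le(1)[OF simple H(1) excess(2)] by blast
  also have "\<dots> \<le> (2 * k + 1) * (2 * ?d + 1) ^ Suc p"
    using cardH by (rule mult_right_mono) simp
  finally have "card (ball G H (Suc p)) < card (verts G)"
    using size by linarith
  moreover have "finite (ball G H (Suc p))"
    using card_ball_le(2)[OF simple H(1) excess(2)] fin finite_subset by blast
  ultimately obtain v where v: "v \<in> verts G" "v \<notin> ball G H (Suc p)"
    using card_mono[of "ball G H (Suc p)" "verts G"] by (meson not_less subsetI)
  have "\<exists>l. z \<in> ball G H l" if "(v0, z) \<in> {(x, y). {x, y} \<in> edges G}\<^sup>*" for z
    using that
  proof (induction rule: rtrancl_induct)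
    case base
    then show ?case
      using H(2) by (intro exI[of _ 0]) simp
  next
    case (step y z)
    then obtain l where "y \<in> ball G H l"
      by blast
    then have "z \<in> ball G H (Suc l)"
      using step(2) by (auto simp: neighbours_def)
    then show ?case ..
  qed
  then have "\<exists>l. v \<in> ball G H l"
    using conn v0 v(1) unfolding connected_graph_def by blast
  then obtain l where l: "v \<in> ball G H l" "\<And>i. i < l \<Longrightarrow> v \<notin> ball G H i"
    using exists_least_iff[of "\<lambda>l. v \<in> ball G H l"] by blast
  have "Suc p < l"
    using v(2) l(1) ball_mono[of l "Suc p" G H] by (meson not_less subsetD)
  obtain f where f: "\<And>i. i \<le> l \<Longrightarrow> f i \<in> ball G H i" "\<And>i j. i \<le> l \<Longrightarrow> j < i \<Longrightarrow> f i \<notin> ball G H j"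
    "\<And>i. i < l \<Longrightarrow> {f i, f (Suc i)} \<in> edges G"
    using geodesic[OF l] by blast
  have fV: "f i \<in> verts G" if "i \<le> l" for i
    using f(1)[OF that] card_ball_le(2)[OF simple H(1) excess(2)] by blast
  have "degree G (f i) = 2" if "0 < i" "i \<le> l" for i
  proof -
    have "f i \<notin> H"
      using f(2)[of i 0] that by simp
    then show ?thesis
      using fV[OF that(2)] deg2 unfolding H_def by force
  qed
  moreover have "inj_on (\<lambda>i. f (Suc i)) {..p}"
  proof (rule linorder_inj_onI)
    fix i j
    assume "i < j" "j \<in> {..p}"
    then show "f (Suc i) \<noteq> f (Suc j)"
      using f(1)[of "Suc i"] f(2)[of "Suc j" "Suc i"] \<open>Suc p < l\<close> by fastforce
  qed auto
  ultimately show "\<exists>y. thread G p y"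
    using f(3) fV \<open>Suc p < l\<close> unfolding thread_def
    by (intro exI[of _ "\<lambda>i. f (Suc i)"]) auto
qed

section \<open>Peeling off a red copy\<close>

text \<open>The rerouting of Bondy and Erdos: if \<open>b\<close> sees \<open>x i\<close> and \<open>x j\<close>, and the successors of these two
vertices are adjacent, then
\<open>x 0, \<dots>, x i, b, x j, x (j - 1), \<dots>, x (i + 1), x (j + 1), \<dots>, x q\<close>
is a path that is longer by the vertex \<open>b\<close> and has the same ends.\<close>
lemma insert_vertex_into_path:
  fixes x :: "nat \<Rightarrow> 'b"
  assumes inj: "inj_on x {..q}" and path: "\<And>i. i < q \<Longrightarrow> {x i, x (Suc i)} \<in> E"
    and b: "b \<notin> x ` {..q}" "{x i, b} \<in> E" "{x j, b} \<in> E"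
    and ij: "i < j" "j < q" and chord: "{x (Suc i), x (Suc j)} \<in> E"
  obtains z where "inj_on z {..Suc q}" "z ` {..Suc q} \<subseteq> insert b (x ` {..q})"
    "\<And>l. l \<le> q \<Longrightarrow> {z l, z (Suc l)} \<in> E" "z 0 = x 0" "z (Suc q) = x q"
proof
  \<comment> \<open>the position in \<open>x\<close> of the vertex number \<open>l\<close> of the new path; position \<open>i + 1\<close> is left to \<open>b\<close>\<close>
  define s where "s l = (if l \<le> i then l else if l \<le> Suc j then i + j + 2 - l else l - 1)" for l
  define z where "z l = (if l = Suc i then b else x (s l))" for l
  have s: "s l \<le> q" if "l \<le> Suc q" "l \<noteq> Suc i" for l
    using that ij by (auto simp: s_def)
  have s_inj: "l = l'" if "s l = s l'" "l \<noteq> Suc i" "l' \<noteq> Suc i" for l l'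
    using that ij by (auto simp: s_def split: if_splits)
  show "inj_on z {..Suc q}"
  proof (rule inj_onI)
    fix l l'
    assume l: "l \<in> {..Suc q}" "l' \<in> {..Suc q}" "z l = z l'"
    show "l = l'"
    proof (cases "l = Suc i \<or> l' = Suc i")
      case True
      then show ?thesis
        using l s b(1) by (auto simp: z_def split: if_splits)
    next
      case False
      then have "s l = s l'"
        using l s inj by (auto simp: z_def dest: inj_onD)
      then show ?thesis
        using s_inj False by blast
    qed
  qed
  show "z ` {..Suc q} \<subseteq> insert b (x ` {..q})"
    using s by (auto simp: z_def)
  show "z 0 = x 0" "z (Suc q) = x q"
    using ij by (auto simp: z_def s_def)
  fix l
  assume l: "l \<le> q"
  consider "l < i" | "l = i" | "l = Suc i" | "Suc i < l" "l \<le> j" | "l = Suc j" | "Suc j < l"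
    using ij by linarith
  then show "{z l, z (Suc l)} \<in> E"
  proof cases
    case 1
    then show ?thesis
      using path[of l] ij by (simp add: z_def s_def)
  next
    case 2
    then show ?thesis
      using b(2) by (simp add: z_def s_def)
  next
    case 3
    then have "z (Suc l) = x j"
      using ij by (simp add: z_def s_def)
    then show ?thesis
      using 3 b(3) by (simp add: z_def insert_commute)
  next
    case 4
    then have "z l = x (Suc (i + j + 1 - l))" "z (Suc l) = x (i + j + 1 - l)"
      by (auto simp: z_def s_def Suc_diff_le)
    then show ?thesis
      using path[of "i + j + 1 - l"] 4 ij by (simp add: insert_commute)
  next
    case 5
    then have "z l = x (Suc i)" "z (Suc l) = x (Suc j)"
      using ij by (auto simp: z_def s_def)
    then show ?thesis
      using chord by simp
  next
    case 6
    then have "z l = x (l - 1)" "z (Suc l) = x (Suc (l - 1))"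
      using ij by (auto simp: z_def s_def)
    then show ?thesis
      using path[of "l - 1"] 6 l by simp
  qed
qed

lemma degree_2_neighbour:
  assumes G: "simple_graph G" and deg: "degree G v = 2"
    and e: "{v, a} \<in> edges G" "{v, b} \<in> edges G" "a \<noteq> b" and c: "{v, c} \<in> edges G"
  shows "c = a \<or> c = b"
proof -
  have ab: "{v, a} \<noteq> {v, b}"
    using e(3) by (auto simp: doubleton_eq_iff)
  have two: "{{v, a}, {v, b}} = {e \<in> edges G. v \<in> e}"
  proof (rule card_subset_eq)
    show "finite {e \<in> edges G. v \<in> e}"
      using finite_edges[OF G] by simp
    show "{{v, a}, {v, b}} \<subseteq> {e \<in> edges G. v \<in> e}"
      using e by blast
    show "card {{v, a}, {v, b}} = card {e \<in> edges G. v \<in> e}"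
      using ab deg by (simp add: degree_def)
  qed
  have "{v, c} \<in> {e \<in> edges G. v \<in> e}"
    using c by simp
  then have "{v, c} = {v, a} \<or> {v, c} = {v, b}"
    unfolding two[symmetric] by simp
  then show ?thesis
    by (auto simp: doubleton_eq_iff)
qed

lemma thread_edge:
  assumes G: "simple_graph G" and y: "thread G p y" and l: "0 < l" "l < p"
    and c: "{y l, c} \<in> edges G"
  shows "c = y (l - 1) \<or> c = y (Suc l)"
proof -
  have "\<And>i. i < p \<Longrightarrow> {y i, y (Suc i)} \<in> edges G"
    using y unfolding thread_def by blast
  from this[of "l - 1"] this[of l]
  have "{y (l - 1), y (Suc (l - 1))} \<in> edges G" "{y l, y (Suc l)} \<in> edges G"
    using l by auto
  moreover have "degree G (y l) = 2"
    using y l unfolding thread_def by auto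
  moreover have "y (l - 1) \<noteq> y (Suc l)"
    using y l unfolding thread_def by (auto dest!: inj_onD[of _ _ "l - 1" "Suc l"])
  ultimately show ?thesis
    using degree_2_neighbour[OF G _ _ _ _ c, of "y (l - 1)" "y (Suc l)"] l
    by (simp add: insert_commute)
qed

text \<open>Inner vertices of a thread have no edges besides those of the thread. So the image of the thread
may be replaced by any other path with the same ends that avoids the rest of the copy, in
particular by one that has the additional vertex needed to undo the contraction.\<close>
lemma embeds_by_rerouting:
  assumes G: "simple_graph G" and y: "thread G p y" and p: "3 \<le> p"
    and f: "embedding (contract G (y 1) (y 0)) E U f"
    and z: "inj_on z {..p}" "z ` {..p} \<subseteq> U" "\<And>l. l < p \<Longrightarrow> {z l, z (Suc l)} \<in> E"
      "z 0 = f (y 0)" "z p = f (y p)"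
      "z ` {..p} \<inter> f ` (verts G - y ` {..p}) = {}"
  shows "embeds G E U"
proof -
  have y_inj: "inj_on y {..p}"
    using y unfolding thread_def by blast
  define g where "g v = (if v \<in> y ` {..p} then z (inv_into {..p} y v) else f v)" for v
  have g_y: "g (y l) = z l" if "l \<le> p" for l
    using that inv_into_f_f[OF y_inj, of l] by (simp add: g_def)
  have g_f: "g v = f v" if "\<And>l. 0 < l \<Longrightarrow> l < p \<Longrightarrow> v \<noteq> y l" for v
  proof (cases "v \<in> y ` {..p}")
    case True
    then obtain l where l: "l \<le> p" "v = y l"
      by blast
    then have "l = 0 \<or> l = p"
      using that[of l] by linarith
    then show ?thesis
      using l g_y z by auto
  qed (simp add: g_def)
  have f_inj: "inj_on f (verts G - {y 1})" and f_U: "f ` (verts G - {y 1}) \<subseteq> U"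
    and f_E: "{a, c} \<in> edges (contract G (y 1) (y 0)) \<Longrightarrow> {f a, f c} \<in> E" for a c
    using f unfolding embedding_def by (auto simp: contract_def)
  have y1: "y 1 \<in> y ` {..p}"
    using p by auto
  have "inj_on g (verts G)"
  proof (rule inj_onI)
    fix a c
    assume ac: "a \<in> verts G" "c \<in> verts G" "g a = g c"
    consider "a \<in> y ` {..p}" "c \<in> y ` {..p}" | "a \<in> y ` {..p}" "c \<notin> y ` {..p}"
      | "a \<notin> y ` {..p}" "c \<in> y ` {..p}" | "a \<notin> y ` {..p}" "c \<notin> y ` {..p}"
      by blast
    then show "a = c"
    proof cases
      case 1
      then obtain l l' where l: "l \<le> p" "l' \<le> p" "a = y l" "c = y l'"
        by blast
      then have "z l = z l'"
        using ac(3) g_y by simp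
      then show ?thesis
        using l z(1) by (auto dest: inj_onD)
    next
      case 2
      then obtain l where l: "l \<le> p" "a = y l"
        by blast
      then have "z l = f c"
        using ac(3) g_y 2 by (simp add: g_def)
      then show ?thesis
        using l(1) ac(2) 2 z(6) by blast
    next
      case 3
      then obtain l where l: "l \<le> p" "c = y l"
        by blast
      then have "z l = f a"
        using ac(3) g_y 3 by (simp add: g_def)
      then show ?thesis
        using l(1) ac(1) 3 z(6) by blast
    next
      case 4
      then have "f a = f c" "a \<noteq> y 1" "c \<noteq> y 1"
        using ac(3) y1 by (auto simp: g_def)
      then show ?thesis
        using f_inj ac by (auto dest: inj_onD)
    qed
  qed
  moreover have "g ` verts G \<subseteq> U"
  proof
    fix b
    assume "b \<in> g ` verts G"
    then obtain v where v: "v \<in> verts G" "b = g v"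
      by blast
    show "b \<in> U"
    proof (cases "v \<in> y ` {..p}")
      case True
      then show ?thesis
        using g_y z(2) v by auto
    next
      case False
      then have "v \<noteq> y 1"
        using y1 by blast
      then show ?thesis
        using False f_U v by (auto simp: g_def)
    qed
  qed
  moreover have "{g a, g c} \<in> E" if ac: "{a, c} \<in> edges G" for a c
  proof -
    have inner: "{g a, g c} \<in> E" if "{a, c} \<in> edges G" "0 < l" "l < p" "a = y l" for a c l
    proof -
      have "c = y (l - 1) \<or> c = y (Suc l)"
        using thread_edge[OF G y that(2,3)] that by blast
      then show ?thesis
        using that g_y z(3)[of "l - 1"] z(3)[of l] by (auto simp: insert_commute)
    qed
    show ?thesis
    proof (cases "\<exists>l. 0 < l \<and> l < p \<and> (a = y l \<or> c = y l)")
      case True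
      then show ?thesis
        using inner[of a c] inner[of c a] ac by (auto simp: insert_commute)
    next
      case False
      then have "\<not> (0 < (1 :: nat) \<and> 1 < p \<and> (a = y 1 \<or> c = y 1))"
        by blast
      then have "a \<noteq> y 1" "c \<noteq> y 1"
        using p by auto
      moreover have "g a = f a" "g c = f c"
        using False by (auto intro!: g_f)
      moreover from calculation have "{a, c} \<noteq> {y 1, y 0}"
        by (auto simp: doubleton_eq_iff)
      ultimately show ?thesis
        using contract_edgeI[OF ac, of "y 1" "y 0"] f_E[of a c] by simp
    qed
  qed
  ultimately show ?thesis
    unfolding embeds_def embedding_def by (intro exI[of _ g]) simp
qed

text \<open>A blue \<open>M\<close>-clique \<open>B\<close> off the copy has a vertex \<open>b\<close> that is red to the image of \<open>w\<close>, because that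
image together with \<open>B\<close> is not a blue clique; the leaf \<open>u\<close> can be placed on \<open>b\<close>.\<close>
lemma peel_leaf:
  assumes G: "simple_graph G" and leaf: "{u, w} \<in> edges G" "degree G u = 1"
    and f: "embedding (contract G u w) E U f"
    and free: "indep_free (Suc M) E U" and no_copy: "\<not> embeds G E U" and U: "finite U"
  shows "indep_free M E (U - f ` (verts G - {u}))"
  unfolding indep_free_def
proof (intro allI impI notI)
  fix B
  assume B: "B \<subseteq> U - f ` (verts G - {u})" "card B = M" "indep B E"
  note uw = simple_graph_edgeD[OF G leaf(1)]
  have f_inj: "inj_on f (verts G - {u})" and f_U: "f ` (verts G - {u}) \<subseteq> U"
    and f_E: "{a, c} \<in> edges (contract G u w) \<Longrightarrow> {f a, f c} \<in> E" for a c
    using f unfolding embedding_def by (auto simp: contract_def)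
  have fw: "f w \<in> U" "f w \<notin> B"
    using uw f_U B(1) by auto
  have "finite B"
    using B(1) U finite_subset by blast
  then have "card (insert (f w) B) = Suc M"
    using fw B(2) by simp
  then have "\<not> indep (insert (f w) B) E"
    using free fw(1) B(1) unfolding indep_free_def by (metis Diff_subset dual_order.trans insert_subset)
  then obtain b where b: "b \<in> B" "{f w, b} \<in> E"
    using indep_insert[OF B(3)] by blast
  have only: "e = {u, w}" if "e \<in> edges G" "u \<in> e" for e
    using leaf that unfolding degree_def
    by (metis (mono_tags, lifting) card_1_singletonE insertI1 mem_Collect_eq singletonD)
  have "inj_on (f(u := b)) (verts G)"
  proof (rule inj_onI)
    fix a c
    assume "a \<in> verts G" "c \<in> verts G" "(f(u := b)) a = (f(u := b)) c"
    then show "a = c"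
      using f_inj b(1) B(1) by (auto dest: inj_onD split: if_splits)
  qed
  moreover have "(f(u := b)) ` verts G \<subseteq> U"
    using f_U b(1) B(1) by auto
  moreover have "{(f(u := b)) a, (f(u := b)) c} \<in> E" if ac: "{a, c} \<in> edges G" for a c
  proof (cases "u \<in> {a, c}")
    case True
    then have "a = u \<and> c = w \<or> a = w \<and> c = u"
      using only[OF ac] by (auto simp: doubleton_eq_iff)
    then show ?thesis
      using b(2) uw(1) by (auto simp: insert_commute)
  next
    case False
    then show ?thesis
      using contract_edgeI[OF ac, of u w] f_E[of a c] by (auto simp: doubleton_eq_iff)
  qed
  ultimately have "embeds G E U"
    unfolding embeds_def embedding_def by (intro exI[of _ "f(u := b)"]) simp
  then show False
    using no_copy by blast
qed

text \<open>Let \<open>B\<close> be a blue \<open>M\<close>-clique off the copy. Every vertex of the copied thread is red to some vertex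
of \<open>B\<close>. More than \<open>M\<^sup>2\<close> of these vertices have a successor on the thread, so \<open>M + 1\<close> of them
are red to the same \<open>b \<in> B\<close>. Their successors do not form a blue clique, and a red edge between
two of these successors allows \<open>b\<close> to be inserted into the path.\<close>
lemma peel_thread:
  assumes G: "simple_graph G" and y: "thread G p y" and p: "M * M + 2 < p"
    and f: "embedding (contract G (y 1) (y 0)) E U f"
    and free: "indep_free (Suc M) E U" and no_copy: "\<not> embeds G E U" and U: "finite U"
  shows "indep_free M E (U - f ` (verts G - {y 1}))"
  unfolding indep_free_def
proof (intro allI impI notI)
  fix B
  assume B: "B \<subseteq> U - f ` (verts G - {y 1})" "card B = M" "indep B E"
  have fin_B: "finite B"
    using B(1) U finite_subset by blast
  have f_inj: "inj_on f (verts G - {y 1})" and f_U: "f ` (verts G - {y 1}) \<subseteq> U"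
    and f_E: "{a, c} \<in> edges (contract G (y 1) (y 0)) \<Longrightarrow> {f a, f c} \<in> E" for a c
    using f unfolding embedding_def by (auto simp: contract_def)
  define q where "q = p - 1"
  have q: "p = Suc q" "M * M < q"
    using p by (auto simp: q_def)
  \<comment> \<open>after \<open>y 1\<close> is merged into \<open>y 0\<close>, the thread reads \<open>y 0, y 2, y 3, \<dots>\<close>; its copy is \<open>x 0, x 1, \<dots>\<close>\<close>
  define s where "s i = (if i = 0 then 0 else Suc i)" for i :: nat
  define x where "x i = f (y (s i))" for i
  have y_inj: "inj_on y {..p}" and y_V: "y ` {..p} \<subseteq> verts G"
    and y_edge: "\<And>i. i < p \<Longrightarrow> {y i, y (Suc i)} \<in> edges G"
    using y unfolding thread_def by auto
  have y_eq: "y i = y j \<longleftrightarrow> i = j" if "i \<le> p" "j \<le> p" for i j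
    using y_inj that by (auto dest: inj_onD)
  have s: "s i \<le> p" "s i \<noteq> 1" if "i \<le> q" for i
    using that q by (auto simp: s_def)
  have ys: "y (s i) \<in> verts G - {y 1}" if "i \<le> q" for i
    using s[OF that] y_V y_eq[of "s i" 1] q by auto
  have x_inj: "inj_on x {..q}"
  proof (rule inj_onI)
    fix i j
    assume ij: "i \<in> {..q}" "j \<in> {..q}" "x i = x j"
    then have "y (s i) = y (s j)"
      using ys f_inj by (auto simp: x_def dest!: inj_onD)
    then have "s i = s j"
      using y_eq s ij by auto
    then show "i = j"
      by (auto simp: s_def split: if_splits)
  qed
  have x_path: "{x i, x (Suc i)} \<in> E" if "i < q" for i
  proof -
    let ?a = "y (Suc i)" and ?c = "y (Suc (Suc i))"
    have e: "{?a, ?c} \<in> edges G"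
      using y_edge[of "Suc i"] that q by simp
    have ne: "?c \<noteq> y 1" "?c \<noteq> y 0" "?a = y 1 \<longleftrightarrow> i = 0"
      using y_eq[of "Suc (Suc i)" 1] y_eq[of "Suc (Suc i)" 0] y_eq[of "Suc i" 1] that q by auto
    then have "{?a, ?c} \<noteq> {y 1, y 0}"
      by (simp add: doubleton_eq_iff)
    from contract_edgeI[OF e this] have "{if i = 0 then y 0 else ?a, ?c} \<in> edges (contract G (y 1) (y 0))"
      using ne by simp
    then show ?thesis
      using f_E[of "if i = 0 then y 0 else ?a" ?c] by (cases "i = 0") (simp_all add: x_def s_def)
  qed
  have x_UB: "x i \<in> U" "x i \<notin> B" if "i \<le> q" for i
    using ys[OF that] f_U B(1) by (auto simp: x_def)
  have "\<exists>b\<in>B. {x i, b} \<in> E" if "i < q" for i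
  proof -
    have "card (insert (x i) B) = Suc M"
      using x_UB[of i] that fin_B B(2) by simp
    moreover have "insert (x i) B \<subseteq> U"
      using x_UB[of i] that B(1) by auto
    ultimately have "\<not> indep (insert (x i) B) E"
      using free unfolding indep_free_def by blast
    then show ?thesis
      using indep_insert[OF B(3)] by blast
  qed
  then have cover: "{..<q} = (\<Union>b\<in>B. {i. i < q \<and> {x i, b} \<in> E})"
    by auto
  have "\<exists>b\<in>B. M < card {i. i < q \<and> {x i, b} \<in> E}"
  proof (rule ccontr)
    assume "\<not> ?thesis"
    then have "(\<Sum>b\<in>B. card {i. i < q \<and> {x i, b} \<in> E}) \<le> (\<Sum>b\<in>B. M)"
      by (intro sum_mono) (simp add: not_less)
    moreover have "q = card (\<Union>b\<in>B. {i. i < q \<and> {x i, b} \<in> E})"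
      unfolding cover[symmetric] by simp
    ultimately have "q \<le> (\<Sum>b\<in>B. M)"
      using card_UN_le[OF fin_B, of "\<lambda>b. {i. i < q \<and> {x i, b} \<in> E}"] by linarith
    then show False
      using q B(2) by simp
  qed
  then obtain b where b: "b \<in> B" "M < card {i. i < q \<and> {x i, b} \<in> E}"
    by blast
  define J where "J = {i. i < q \<and> {x i, b} \<in> E}"
  have "inj_on (\<lambda>i. x (Suc i)) J"
    by (rule inj_onI) (use inj_onD[OF x_inj, of "Suc i" "Suc j" for i j] in \<open>auto simp: J_def\<close>)
  then have "Suc M \<le> card ((\<lambda>i. x (Suc i)) ` J)"
    using b(2) by (simp add: card_image J_def)
  moreover have "(\<lambda>i. x (Suc i)) ` J \<subseteq> U"
    using x_UB by (auto simp: J_def)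
  ultimately obtain c d where "c \<in> (\<lambda>i. x (Suc i)) ` J" "d \<in> (\<lambda>i. x (Suc i)) ` J" "c \<noteq> d" "{c, d} \<in> E"
    using indep_freeE[OF free, of "(\<lambda>i. x (Suc i)) ` J"] by blast
  then obtain i j where ij: "i \<in> J" "j \<in> J" "x (Suc i) \<noteq> x (Suc j)" "{x (Suc i), x (Suc j)} \<in> E"
    by auto
  have "\<exists>i j. i \<in> J \<and> j \<in> J \<and> i < j \<and> {x (Suc i), x (Suc j)} \<in> E"
  proof (cases "i < j")
    case False
    then have "j < i"
      using ij(3) by (metis linorder_neqE_nat)
    then show ?thesis
      using ij by (metis insert_commute)
  qed (use ij in blast)
  then obtain i j where ij: "i < j" "j < q" "{x i, b} \<in> E" "{x j, b} \<in> E" "{x (Suc i), x (Suc j)} \<in> E"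
    unfolding J_def by blast
  have "b \<notin> x ` {..q}"
    using x_UB b(1) by auto
  from insert_vertex_into_path[OF x_inj x_path this ij(3,4,1,2,5)]
  obtain z where z: "inj_on z {..Suc q}" "z ` {..Suc q} \<subseteq> insert b (x ` {..q})"
    "\<And>l. l \<le> q \<Longrightarrow> {z l, z (Suc l)} \<in> E" "z 0 = x 0" "z (Suc q) = x q"
    by blast
  have x_new: "x i \<notin> f ` (verts G - y ` {..p})" if "i \<le> q" for i
  proof
    assume "x i \<in> f ` (verts G - y ` {..p})"
    then obtain v where v: "v \<in> verts G" "v \<notin> y ` {..p}" "f (y (s i)) = f v"
      by (auto simp: x_def)
    moreover have "v \<noteq> y 1"
      using v(2) q by auto
    ultimately have "y (s i) = v"
      using ys[OF that] f_inj by (auto dest: inj_onD)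
    then show False
      using v(2) s(1)[OF that] by blast
  qed
  have b_new: "b \<notin> f ` (verts G - y ` {..p})"
  proof -
    have "y 1 \<in> y ` {..p}"
      using q by auto
    then have "f ` (verts G - y ` {..p}) \<subseteq> f ` (verts G - {y 1})"
      by blast
    then show ?thesis
      using b(1) B(1) by blast
  qed
  have z_range: "z ` {..p} \<subseteq> insert b (x ` {..q})"
    using z(2) q(1) by simp
  have "insert b (x ` {..q}) \<inter> f ` (verts G - y ` {..p}) = {}"
    using x_new b_new by auto
  then have "z ` {..p} \<inter> f ` (verts G - y ` {..p}) = {}"
    using Int_mono[OF z_range order_refl[of "f ` (verts G - y ` {..p})"]] by (simp only: subset_empty)
  moreover have "insert b (x ` {..q}) \<subseteq> U"
    using x_UB(1) b(1) B(1) by auto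
  then have "z ` {..p} \<subseteq> U"
    using z_range by (rule order_trans[rotated])
  moreover have "z 0 = f (y 0)" "z p = f (y p)"
    using z(4,5) q by (auto simp: x_def s_def)
  ultimately have "embeds G E U"
    using embeds_by_rerouting[OF G y _ f, of z] z q p by auto
  then show False
    using no_copy by blast
qed

text \<open>By induction on the size of \<open>G\<close>: contract a leaf edge or the first edge of a long thread. If the
smaller graph has no red copy either, the induction hypothesis applies; if it has one, the vertices
off this copy are the required set. Graphs of bounded size cannot occur, as
Ramsey's theorem gives a red clique that contains them.\<close>
lemma peel:
  fixes k M :: nat
  shows "\<exists>R. \<forall>(G :: 'a sgraph) (E :: 'b set set) U. sparse k G \<longrightarrow> finite U \<longrightarrow> R \<le> card U \<longrightarrow>
     indep_free (Suc M) E U \<longrightarrow> \<not> embeds G E U \<longrightarrow>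
     (\<exists>W\<subseteq>U. card U \<le> card W + (card (verts G) - 1) \<and> indep_free M E W)"
proof -
  define p where "p = M * M + 3"
  obtain S where S: "\<And>G :: 'a sgraph. sparse k G \<Longrightarrow> S \<le> card (verts G) \<Longrightarrow>
      (\<forall>v\<in>verts G. degree G v \<noteq> 1) \<Longrightarrow> \<exists>y. thread G p y"
    using long_thread[of k p] by blast
  obtain R where R: "\<And>(V :: 'b set) (E :: 'b set set). finite V \<Longrightarrow> R \<le> card V \<Longrightarrow>
      \<exists>K\<subseteq>V. card K = S \<and> clique K E \<or> card K = Suc M \<and> indep K E"
    using ramsey2[of S "Suc M"] by metis
  have "\<exists>W\<subseteq>U. card U \<le> card W + (card (verts G) - 1) \<and> indep_free M E W"
    if G: "sparse k G" and U: "finite U" "R \<le> card U" and free: "indep_free (Suc M) E U"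
      and no_copy: "\<not> embeds G E U"
    for G :: "'a sgraph" and E :: "'b set set" and U
    using G no_copy
  proof (induction "card (verts G)" arbitrary: G rule: less_induct)
    case less
    have simple: "simple_graph G" and fin: "finite (verts G)"
      using less.prems(1) by (auto simp: sparse_def simple_graph_def)
    have big: "S \<le> card (verts G)"
    proof (rule ccontr)
      assume small: "\<not> ?thesis"
      obtain K where K: "K \<subseteq> U" "card K = S \<and> clique K E \<or> card K = Suc M \<and> indep K E"
        using R[OF U] by blast
      then have "card K = S" "clique K E"
        using free unfolding indep_free_def by blast+
      then have "embeds G E K"
        using small K(1) U(1) finite_subset by (intro embeds_in_clique[OF simple]) auto
      then show False
        using embeds_mono K(1) less.prems(2) by blast
    qed
    have shrink: "\<exists>W\<subseteq>U. card U \<le> card W + (card (verts G) - 1) \<and> indep_free M E W"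
      if e: "{u, w} \<in> edges G"
        and step: "\<And>f. embedding (contract G u w) E U f \<Longrightarrow> indep_free M E (U - f ` (verts G - {u}))"
      for u w
    proof (cases "embeds (contract G u w) E U")
      case True
      then obtain f where f: "embedding (contract G u w) E U f"
        unfolding embeds_def by blast
      have "card (f ` (verts G - {u})) \<le> card (verts G) - 1"
        using card_image_le[of "verts G - {u}" f] fin simple_graph_edgeD(2)[OF simple e] by simp
      moreover have "card U \<le> card (U - f ` (verts G - {u})) + card (f ` (verts G - {u}))"
        using diff_card_le_card_Diff[of "f ` (verts G - {u})" U] fin by simp
      ultimately have "card U \<le> card (U - f ` (verts G - {u})) + (card (verts G) - 1)"
        by linarith
      then show ?thesis
        using step[OF f] by blast
    next
      case False
      obtain W where "W \<subseteq> U" "card U \<le> card W + (card (verts (contract G u w)) - 1)" "indep_free M E W"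
        using less.hyps[OF _ _ False] contract_sparse[OF less.prems(1) e] by auto
      then show ?thesis
        using contract_sparse(2)[OF less.prems(1) e] by (intro exI[of _ W]) auto
    qed
    show ?case
    proof (cases "\<exists>u\<in>verts G. degree G u = 1")
      case True
      then obtain u where u: "u \<in> verts G" "degree G u = 1"
        by blast
      then obtain e where e: "e \<in> edges G" "u \<in> e"
        unfolding degree_def by (metis (mono_tags, lifting) card_1_singletonE insertI1 mem_Collect_eq)
      then obtain w where "e = {u, w}"
        using simple_graph_edgeE[OF simple e(1)] by (metis empty_iff insert_iff insert_commute)
      then have uw: "{u, w} \<in> edges G"
        using e(1) by simp
      show ?thesis
        using peel_leaf[OF simple uw u(2) _ free less.prems(2) U(1)] by (rule shrink[OF uw])
    next
      case False
      then obtain y where y: "thread G p y"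
        using S[OF less.prems(1) big] by blast
      then have "{y 0, y (Suc 0)} \<in> edges G"
        unfolding thread_def p_def by simp
      then have e: "{y 1, y 0} \<in> edges G"
        by (simp add: insert_commute)
      have "M * M + 2 < p"
        by (simp add: p_def)
      show ?thesis
        using peel_thread[OF simple y \<open>M * M + 2 < p\<close> _ free less.prems(2) U(1)]
        by (rule shrink[OF e])
    qed
  qed
  then show ?thesis
    by (intro exI[of _ R]) blast
qed

section \<open>Large red cliques\<close>

lemma clique_if_indep_free_2:
  assumes "indep_free 2 E U"
  shows "clique U E"
  unfolding clique_def
proof (intro ballI impI)
  fix v w
  assume vw: "v \<in> U" "w \<in> U" "v \<noteq> w"
  then have "\<not> indep {v, w} E"
    using assms unfolding indep_free_def by simp
  then show "{v, w} \<in> E"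
    unfolding indep_def by (auto simp: insert_commute)
qed

text \<open>Peeling lowers the size of the forbidden blue clique by one at the price of \<open>card (verts G) - 1\<close>
vertices. The defect \<open>C\<close> does not grow, so after \<open>M\<close> rounds a set without blue edges remains
that misses \<open>card (verts G) - 1\<close> by at most \<open>C\<close>.\<close>
lemma large_red_clique:
  fixes k M C :: nat
  shows "\<exists>n0. \<forall>(G :: 'a sgraph) (E :: 'b set set) U. sparse k G \<longrightarrow> n0 \<le> card (verts G) \<longrightarrow> finite U \<longrightarrow>
     indep_free (Suc (Suc M)) E U \<longrightarrow> \<not> embeds G E U \<longrightarrow>
     (card (verts G) - 1) * Suc M \<le> card U + C \<longrightarrow>
     (\<exists>Q\<subseteq>U. clique Q E \<and> card (verts G) - 1 \<le> card Q + C)"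
proof (induction M)
  case 0
  show ?case
    using clique_if_indep_free_2 by (intro exI[of _ 0]) (auto simp: numeral_2_eq_2)
next
  case (Suc M)
  then obtain n1 where n1: "\<And>(G :: 'a sgraph) (E :: 'b set set) U. sparse k G \<Longrightarrow> n1 \<le> card (verts G) \<Longrightarrow>
      finite U \<Longrightarrow> indep_free (Suc (Suc M)) E U \<Longrightarrow> \<not> embeds G E U \<Longrightarrow>
      (card (verts G) - 1) * Suc M \<le> card U + C \<Longrightarrow>
      \<exists>Q\<subseteq>U. clique Q E \<and> card (verts G) - 1 \<le> card Q + C"
    by metis
  obtain R where R: "\<And>(G :: 'a sgraph) (E :: 'b set set) U. sparse k G \<Longrightarrow> finite U \<Longrightarrow> R \<le> card U \<Longrightarrow>
      indep_free (Suc (Suc (Suc M))) E U \<Longrightarrow> \<not> embeds G E U \<Longrightarrow>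
      \<exists>W\<subseteq>U. card U \<le> card W + (card (verts G) - 1) \<and> indep_free (Suc (Suc M)) E W"
    using peel[of k "Suc (Suc M)"] by metis
  show ?case
  proof (rule exI[of _ "n1 + R + C + 1"], intro allI impI)
    fix G :: "'a sgraph" and E :: "'b set set" and U
    assume G: "sparse k G" "n1 + R + C + 1 \<le> card (verts G)" and U: "finite U"
      "indep_free (Suc (Suc (Suc M))) E U" "\<not> embeds G E U"
      and size: "(card (verts G) - 1) * Suc (Suc M) \<le> card U + C"
    have size': "(card (verts G) - 1) + (card (verts G) - 1) * Suc M \<le> card U + C"
      using size by simp
    then have "R \<le> card U"
      using G(2) by linarith
    then obtain W where W: "W \<subseteq> U" "card U \<le> card W + (card (verts G) - 1)"
      "indep_free (Suc (Suc M)) E W"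
      using R[OF G(1) U(1) _ U(2,3)] by blast
    have "\<not> embeds G E W"
      using embeds_mono W(1) U(3) by blast
    moreover have "(card (verts G) - 1) * Suc M \<le> card W + C"
      using W(2) size' by linarith
    moreover have "finite W"
      using W(1) U(1) finite_subset by blast
    ultimately obtain Q where "Q \<subseteq> W" "clique Q E" "card (verts G) - 1 \<le> card Q + C"
      using n1[OF G(1) _ _ W(3)] G(2) by auto
    then show "\<exists>Q\<subseteq>U. clique Q E \<and> card (verts G) - 1 \<le> card Q + C"
      using W(1) by blast
  qed
qed

section \<open>Embedding into a clique with absorbed vertices\<close>

text \<open>Greedy choice: each chosen vertex excludes itself and at most \<open>2 * d\<close> neighbours.\<close>
lemma independent_subset:
  assumes G: "simple_graph G"
  shows "finite L \<Longrightarrow> (\<And>v. v \<in> L \<Longrightarrow> degree G v \<le> d) \<Longrightarrow> s * (2 * d + 1) \<le> card L \<Longrightarrow>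
    \<exists>I\<subseteq>L. card I = s \<and> I \<inter> neighbours G I = {}"
proof (induction s arbitrary: L)
  case 0
  then show ?case
    by (intro exI[of _ "{}"]) (simp add: neighbours_def)
next
  case (Suc s)
  then obtain v where v: "v \<in> L"
    by fastforce
  let ?N = "neighbours G {v}"
  have N: "finite ?N" "card ?N \<le> 2 * d"
    using card_neighbours_le[OF G, of "{v}" d] Suc.prems(2)[OF v] by auto
  then have "card (insert v ?N) \<le> 2 * d + 1"
    using card_insert_le_m1[of "2 * d + 1" ?N v] by simp
  moreover have "card L - card (insert v ?N) \<le> card (L - insert v ?N)"
    using N(1) by (intro diff_card_le_card_Diff) simp
  moreover have "s * (2 * d + 1) + (2 * d + 1) \<le> card L"
    using Suc.prems(3) by simp
  ultimately have "s * (2 * d + 1) \<le> card (L - insert v ?N)"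
    by linarith
  then obtain I where I: "I \<subseteq> L - insert v ?N" "card I = s" "I \<inter> neighbours G I = {}"
    using Suc.IH[of "L - insert v ?N"] Suc.prems(1,2) by auto
  have "v \<notin> ?N"
    using simple_graph_edgeD(1)[OF G] unfolding neighbours_def by blast
  moreover have "v \<notin> neighbours G I"
    using I(1) unfolding neighbours_def by (auto simp: insert_commute)
  moreover have "neighbours G (insert v I) = ?N \<union> neighbours G I"
    unfolding neighbours_def by blast
  ultimately have "insert v I \<inter> neighbours G (insert v I) = {}"
    using I(1,3) by blast
  moreover have "finite I"
    using I(1) Suc.prems(1) finite_subset by blast
  then have "card (insert v I) = Suc s"
    using I(1,2) by (subst card_insert_disjoint) auto
  ultimately show ?case
    using I(1) v by (intro exI[of _ "insert v I"]) blast
qed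

text \<open>All degrees are positive and their average is close to 2, so nearly half of the vertices
have degree at most 2.\<close>
lemma low_degree_independent_set:
  assumes G: "sparse k G" and size: "10 * s + 2 * k + 2 \<le> card (verts G)"
  obtains I where "I \<subseteq> verts G" "card I = s" "I \<inter> neighbours G I = {}"
    "card (neighbours G I) \<le> 4 * s"
proof -
  have simple: "simple_graph G" and conn: "connected_graph G"
    using G by (auto simp: sparse_def)
  then have fin: "finite (verts G)"
    by (simp add: simple_graph_def)
  define L where "L = {v \<in> verts G. degree G v \<le> 2}"
  define H where "H = {v \<in> verts G. 3 \<le> degree G v}"
  have split: "card (verts G) = card L + card H"
  proof -
    have "verts G = L \<union> H" "L \<inter> H = {}"
      by (auto simp: L_def H_def)
    then show ?thesis
      using fin by (simp add: card_Un_disjoint)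
  qed
  have "(\<Sum>v\<in>verts G. 1 + (if v \<in> H then 2 else 0)) \<le> (\<Sum>v\<in>verts G. degree G v)"
    using degree_pos[OF simple conn] size by (intro sum_mono) (auto simp: H_def)
  moreover have "(\<Sum>v\<in>verts G. 1 + (if v \<in> H then 2 else 0)) = card (verts G) + 2 * card H"
  proof -
    have "verts G \<inter> H = H"
      by (auto simp: H_def)
    then show ?thesis
      using fin by (simp only: sum.distrib flip: sum.inter_restrict) simp
  qed
  ultimately have "card (verts G) \<le> 2 * card L + 2 * k"
    using handshake[OF simple] G split unfolding sparse_def by linarith
  then have size_L: "s * (2 * 2 + 1) \<le> card L"
    using size by simp
  have L: "finite L" "L \<subseteq> verts G" and deg: "\<And>v. v \<in> L \<Longrightarrow> degree G v \<le> 2"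
    using fin by (auto simp: L_def)
  obtain I where I: "I \<subseteq> L" "card I = s" "I \<inter> neighbours G I = {}"
    using independent_subset[OF simple L(1) deg size_L] by blast
  have "finite I"
    using I(1) L(1) finite_subset by blast
  then have "card (neighbours G I) \<le> card I * (2 * 2)"
    using I(1) deg by (intro card_neighbours_le(2)[OF simple]) auto
  then have "card (neighbours G I) \<le> 4 * s"
    using I(2) by simp
  then show ?thesis
    using that[of I] I L(2) by simp
qed

text \<open>Inside the clique \<open>Q\<close> every placement is good, so only the vertices placed on \<open>A\<close> matter. Placing an
independent set there leaves its neighbours as the only vertices that must go to \<open>P\<close>.\<close>
lemma embeds_in_clique_with_absorbed:
  assumes G: "simple_graph G" and I: "I \<subseteq> verts G" "I \<inter> neighbours G I = {}"
    and Q: "finite Q" "clique Q E" "P \<subseteq> Q" and A: "finite A" "A \<inter> Q = {}"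
    and AP: "\<And>a p. a \<in> A \<Longrightarrow> p \<in> P \<Longrightarrow> {a, p} \<in> E"
    and card: "card I = card A" "card (neighbours G I) \<le> card P" "card (verts G) \<le> card Q + card A"
  shows "embeds G E (Q \<union> A)"
proof -
  let ?N = "neighbours G I"
  have fin: "finite (verts G)"
    using G by (simp add: simple_graph_def)
  then have fin': "finite I" "finite ?N" "finite P"
    using I(1) neighbours_subset[OF G] Q finite_subset by blast+
  obtain f where f: "f ` I \<subseteq> A" "inj_on f I"
    using card_le_inj[OF fin'(1) A(1)] card(1) by auto
  obtain g where g: "g ` ?N \<subseteq> P" "inj_on g ?N"
    using card_le_inj[OF fin'(2,3) card(2)] by blast
  have "card (verts G - I - ?N) = card (verts G) - card I - card ?N"
  proof -
    have "card (verts G - I - ?N) = card (verts G - I) - card ?N"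
      using I neighbours_subset[OF G, of I] fin' by (intro card_Diff_subset) auto
    moreover have "card (verts G - I) = card (verts G) - card I"
      using I fin' by (intro card_Diff_subset) auto
    ultimately show ?thesis
      by simp
  qed
  moreover have "card (Q - g ` ?N) = card Q - card ?N"
    using g Q fin' by (subst card_Diff_subset) (auto simp: card_image)
  ultimately have "card (verts G - I - ?N) \<le> card (Q - g ` ?N)"
    using card(1,3) by linarith
  then obtain h where h: "h ` (verts G - I - ?N) \<subseteq> Q - g ` ?N" "inj_on h (verts G - I - ?N)"
    using card_le_inj[of "verts G - I - ?N" "Q - g ` ?N"] fin Q(1) by auto
  define e where "e v = (if v \<in> I then f v else if v \<in> ?N then g v else h v)" for v
  have e_I: "e v \<in> A" if "v \<in> I" for v
    using that f(1) by (auto simp: e_def)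
  have e_N: "e v \<in> P" if "v \<in> ?N" for v
    using that g(1) I(2) by (auto simp: e_def)
  have e_rest: "e v \<in> Q" if "v \<in> verts G" "v \<notin> I" for v
    using that g(1) h(1) Q(3) by (auto simp: e_def)
  have inj: "inj_on e (verts G)"
  proof (rule inj_onI)
    fix a c
    assume ac: "a \<in> verts G" "c \<in> verts G" "e a = e c"
    have iff: "a \<in> I \<longleftrightarrow> c \<in> I"
      using e_I e_rest ac A(2) by (metis disjoint_iff)
    consider "a \<in> I" "c \<in> I" | "a \<notin> I" "c \<notin> I" "a \<in> ?N" "c \<in> ?N" | "a \<notin> I" "c \<notin> I" "a \<notin> ?N" "c \<notin> ?N"
      | "a \<notin> I" "c \<notin> I" "a \<in> ?N" "c \<notin> ?N" | "a \<notin> I" "c \<notin> I" "a \<notin> ?N" "c \<in> ?N"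
      using iff by blast
    then show "a = c"
    proof cases
      case 1
      then show ?thesis
        using ac f(2) by (auto simp: e_def dest: inj_onD)
    next
      case 2
      then show ?thesis
        using ac g(2) by (auto simp: e_def dest: inj_onD)
    next
      case 3
      then show ?thesis
        using ac inj_onD[OF h(2), of a c] by (simp add: e_def)
    next
      case 4
      then have "h c \<in> Q - g ` ?N" "h c = g a"
        using ac h(1) by (auto simp: e_def)
      then show ?thesis
        using 4 by auto
    next
      case 5
      then have "h a \<in> Q - g ` ?N" "h a = g c"
        using ac h(1) by (auto simp: e_def)
      then show ?thesis
        using 5 by auto
    qed
  qed
  have star: "{e a, e c} \<in> E" if "{a, c} \<in> edges G" "a \<in> I" for a c
  proof -
    have "c \<in> ?N"
      using that unfolding neighbours_def by blast
    then show ?thesis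
      using AP[OF e_I[OF that(2)] e_N] by blast
  qed
  have "{e a, e c} \<in> E" if ac: "{a, c} \<in> edges G" for a c
  proof -
    note V = simple_graph_edgeD[OF G ac]
    consider "a \<in> I" | "c \<in> I" | "a \<notin> I" "c \<notin> I"
      by blast
    then show ?thesis
    proof cases
      case 1
      then show ?thesis
        using star ac by blast
    next
      case 2
      then show ?thesis
        using star[of c a] ac by (simp add: insert_commute)
    next
      case 3
      moreover have "e a \<noteq> e c"
        using inj V by (auto dest: inj_onD)
      ultimately show ?thesis
        using e_rest V Q(2) unfolding clique_def by simp
    qed
  qed
  moreover have "e ` verts G \<subseteq> Q \<union> A"
    using e_I e_rest by blast
  ultimately show ?thesis
    using inj unfolding embeds_def embedding_def by (intro exI[of _ e]) simp
qed

text \<open>A vertex \<open>v\<close> that is red to at least the fraction \<open>1 / D\<close> of \<open>P\<close> can be moved to \<open>A\<close> when \<open>P\<close> is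
replaced by its red neighbours in \<open>P\<close>. This divides \<open>P\<close> by at most \<open>D\<close>, which the factor
\<open>D ^ card A\<close> accounts for. As \<open>card A\<close> grows in steps of one and never equals \<open>s\<close>, the process gets
stuck before \<open>s\<close>.\<close>
lemma absorb_maximal:
  fixes E :: "'b set set" and D :: nat
  defines "state \<equiv> \<lambda>Q V A P. A \<subseteq> V - Q \<and> P \<subseteq> Q \<and> card Q \<le> card P * D ^ card A \<and>
    (\<forall>a\<in>A. \<forall>p\<in>P. {a, p} \<in> E)"
  assumes V: "finite V" and Q: "Q \<subseteq> V" and stop: "\<And>A P. state Q V A P \<Longrightarrow> card A \<noteq> s"
  obtains A P where "state Q V A P" "card A < s"
    "\<forall>v\<in>V - Q - A. D * card {p \<in> P. {v, p} \<in> E} < card P"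
proof -
  define St where "St a \<longleftrightarrow> (\<exists>A P. state Q V A P \<and> card A = a)" for a
  have "St 0"
    unfolding St_def state_def by (intro exI[of _ "{}"] exI[of _ Q]) simp
  have "\<not> St s"
    using stop unfolding St_def by blast
  have "\<exists>a<s. St a \<and> \<not> St (Suc a)"
  proof (rule ccontr)
    assume none: "\<not> ?thesis"
    have "a \<le> s \<Longrightarrow> St a" for a
    proof (induction a)
      case 0
      show ?case
        by fact
    next
      case (Suc a)
      then show ?case
        using none by simp
    qed
    then show False
      using \<open>\<not> St s\<close> by simp
  qed
  then obtain A P where AP: "state Q V A P" "card A < s" and max: "\<not> St (Suc (card A))"
    unfolding St_def by blast
  have fin: "finite A" "finite P"
    using AP(1) V Q unfolding state_def by (meson finite_Diff finite_subset)+
  have "D * card {p \<in> P. {v, p} \<in> E} < card P" if v: "v \<in> V - Q - A" for v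
  proof (rule ccontr)
    assume "\<not> ?thesis"
    then have le: "card P \<le> D * card {p \<in> P. {v, p} \<in> E}"
      by simp
    let ?P = "{p \<in> P. {v, p} \<in> E}"
    have "card Q \<le> card P * D ^ card A"
      using AP(1) by (simp add: state_def)
    also have "\<dots> \<le> D * card ?P * D ^ card A"
      using le by (rule mult_right_mono) simp
    also have "\<dots> = card ?P * D ^ card (insert v A)"
      using fin(1) v by (simp add: algebra_simps)
    finally have "state Q V (insert v A) ?P"
      using AP(1) v unfolding state_def by auto
    moreover have "card (insert v A) = Suc (card A)"
      using fin(1) v by simp
    ultimately show False
      using max unfolding St_def by blast
  qed
  then show ?thesis
    using AP that by blast
qed

section \<open>Packing blue cliques\<close>

text \<open>For \<open>E\<close> the set of red edges: the disjoint blue cliques that make up a copy of \<open>tK\<^sub>m\<close>.\<close>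
definition packing :: "nat \<Rightarrow> nat \<Rightarrow> 'b set set \<Rightarrow> 'b set \<Rightarrow> bool" where
  "packing t m E V \<longleftrightarrow> (\<exists>K. (\<forall>i<t. K i \<subseteq> V \<and> card (K i) = m \<and> indep (K i) E) \<and>
     (\<forall>i<t. \<forall>j<t. i \<noteq> j \<longrightarrow> K i \<inter> K j = {}))"

lemma greedy_packing:
  assumes V: "finite V"
  shows "packing t m E V \<or> (\<exists>U\<subseteq>V. card V \<le> card U + t * m \<and> indep_free m E U)"
proof (induction t)
  case 0
  then show ?case
    by (simp add: packing_def)
next
  case (Suc t)
  then show ?case
  proof
    assume "\<exists>U\<subseteq>V. card V \<le> card U + t * m \<and> indep_free m E U"
    then obtain U where "U \<subseteq> V" "card V \<le> card U + t * m" "indep_free m E U"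
      by blast
    then show ?thesis
      by (intro disjI2 exI[of _ U]) simp
  next
    assume "packing t m E V"
    then obtain K where K: "\<And>i. i < t \<Longrightarrow> K i \<subseteq> V \<and> card (K i) = m \<and> indep (K i) E"
      and disj: "\<And>i j. i < t \<Longrightarrow> j < t \<Longrightarrow> i \<noteq> j \<Longrightarrow> K i \<inter> K j = {}"
      unfolding packing_def by blast
    define X where "X = (\<Union>i<t. K i)"
    have "finite X"
      using K V finite_subset unfolding X_def by blast
    have "card X \<le> (\<Sum>i<t. card (K i))"
      unfolding X_def by (rule card_UN_le) simp
    also have "\<dots> = t * m"
      using K by simp
    finally have "card V \<le> card (V - X) + t * m"
      using diff_card_le_card_Diff[OF \<open>finite X\<close>, of V] by linarith
    show ?thesis
    proof (cases "indep_free m E (V - X)")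
      case True
      then show ?thesis
        using \<open>card V \<le> card (V - X) + t * m\<close> by (intro disjI2 exI[of _ "V - X"]) auto
    next
      case False
      then obtain L where L: "L \<subseteq> V - X" "card L = m" "indep L E"
        unfolding indep_free_def by blast
      have "K i \<inter> L = {}" if "i < t" for i
        using L(1) that unfolding X_def by blast
      then have "packing (Suc t) m E V"
        unfolding packing_def using K disj L
        by (intro exI[of _ "K(t := L)"]) (auto simp: less_Suc_eq)
      then show ?thesis ..
    qed
  qed
qed

text \<open>The cliques of the given packing have \<open>t * m\<close> vertices in total. Each of these is red to at most the
fraction \<open>1 / (t * m + 1)\<close> of \<open>P\<close>, so at least that fraction of \<open>P\<close>, hence at least \<open>t\<close>
vertices, is blue to all of them and supplies one new vertex per clique.\<close>
lemma packing_extend: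
  assumes K: "packing t m E W" and P: "finite P" "P \<inter> W = {}"
    and few: "\<And>v. v \<in> W \<Longrightarrow> (t * m + 1) * card {p \<in> P. {v, p} \<in> E} \<le> card P"
    and large: "(t * m + 1) * t \<le> card P" and W: "finite W"
  shows "packing t (Suc m) E (P \<union> W)"
proof -
  let ?D = "t * m + 1"
  obtain K where "\<forall>i<t. K i \<subseteq> W \<and> card (K i) = m \<and> indep (K i) E"
    and disj: "\<forall>i<t. \<forall>j<t. i \<noteq> j \<longrightarrow> K i \<inter> K j = {}"
    using K unfolding packing_def by blast
  then have K: "\<And>i. i < t \<Longrightarrow> K i \<subseteq> W" "\<And>i. i < t \<Longrightarrow> card (K i) = m" "\<And>i. i < t \<Longrightarrow> indep (K i) E"
    by simp_all
  define X where "X = (\<Union>i<t. K i)"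
  have X: "X \<subseteq> W"
    using K(1) unfolding X_def by blast
  then have finX: "finite X"
    using W finite_subset by blast
  have "card X \<le> (\<Sum>i<t. card (K i))"
    unfolding X_def by (rule card_UN_le) simp
  also have "\<dots> = t * m"
    using K(2) by simp
  finally have cardX: "card X \<le> t * m" .
  \<comment> \<open>the vertices of \<open>P\<close> that are unusable because of some red edge to the packing\<close>
  define B where "B = (\<Union>x\<in>X. {p \<in> P. {x, p} \<in> E})"
  have "card B \<le> (\<Sum>x\<in>X. card {p \<in> P. {x, p} \<in> E})"
    unfolding B_def using finX by (rule card_UN_le)
  then have "?D * card B \<le> ?D * (\<Sum>x\<in>X. card {p \<in> P. {x, p} \<in> E})"
    by (rule mult_left_mono) simp
  also have "\<dots> = (\<Sum>x\<in>X. ?D * card {p \<in> P. {x, p} \<in> E})"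
    by (rule sum_distrib_left)
  also have "\<dots> \<le> (\<Sum>x\<in>X. card P)"
    using few X by (intro sum_mono) blast
  also have "\<dots> \<le> t * m * card P"
    using cardX by simp
  finally have B: "?D * card B \<le> t * m * card P" .
  have "B \<subseteq> P"
    unfolding B_def by blast
  then have "card P = card (P - B) + card B"
    using P(1) by (metis card_Diff_subset card_mono finite_subset le_add_diff_inverse2)
  then have "?D * card P = ?D * card (P - B) + ?D * card B"
    by (metis distrib_left)
  then have "card P \<le> ?D * card (P - B)"
    using B by simp
  then have "?D * t \<le> ?D * card (P - B)"
    using large by linarith
  then have "t \<le> card (P - B)"
    by (rule mult_left_le_imp_le) simp
  then have "card {..<t} \<le> card (P - B)"
    by simp
  then obtain f where f: "f ` {..<t} \<subseteq> P - B" "inj_on f {..<t}"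
    using card_le_inj[of "{..<t}" "P - B"] P(1) by auto
  have fP: "f i \<in> P" "f i \<notin> W" if "i < t" for i
    using f(1) P(2) that by auto
  have blue: "{f i, x} \<notin> E" if "i < t" "x \<in> K i" for i x
  proof -
    have "x \<in> X"
      using that unfolding X_def by blast
    then show ?thesis
      using f(1) that(1) unfolding B_def by (auto simp: insert_commute)
  qed
  show ?thesis
    unfolding packing_def
  proof (intro exI[of _ "\<lambda>i. insert (f i) (K i)"] conjI allI impI)
    fix i
    assume i: "i < t"
    show "insert (f i) (K i) \<subseteq> P \<union> W"
      using fP[OF i] K(1)[OF i] by blast
    have "finite (K i)" "f i \<notin> K i"
      using K(1)[OF i] W fP[OF i] by (auto intro: finite_subset)
    then show "card (insert (f i) (K i)) = Suc m"
      using K(2)[OF i] by simp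
    show "indep (insert (f i) (K i)) E"
      using indep_insert[OF K(3)[OF i]] blue[OF i] by blast
    fix j
    assume j: "j < t" "i \<noteq> j"
    have "f i \<noteq> f j"
      using f(2) i j by (auto dest: inj_onD)
    then show "insert (f i) (K i) \<inter> insert (f j) (K j) = {}"
      using disj i j fP[OF i] fP[OF j(1)] K(1)[OF i] K(1)[OF j(1)] by auto
  qed
qed

section \<open>The upper bound\<close>

lemma packing_mono:
  assumes "packing t m E V" "V \<subseteq> V'"
  shows "packing t m E V'"
  using assms unfolding packing_def by (meson order_trans)

text \<open>The upper bound, with \<open>m = M + 1\<close>. A large red clique \<open>Q\<close> exists unless there is a packing at
once. The absorbed set \<open>A\<close> keeps \<open>card Q + card A\<close> below the size of \<open>G\<close>, and precisely because of this
the remaining vertices are numerous enough for the induction hypothesis with the same \<open>t\<close>.\<close>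
lemma packing_if_no_copy:
  fixes k t M :: nat
  shows "\<exists>n0. \<forall>(G :: 'a sgraph) (E :: 'b set set) V. sparse k G \<longrightarrow> n0 \<le> card (verts G) \<longrightarrow> finite V \<longrightarrow>
     (card (verts G) - 1) * M + t \<le> card V \<longrightarrow> \<not> embeds G E V \<longrightarrow> packing t (Suc M) E V"
proof (induction M)
  case 0
  have "packing t (Suc 0) E V" if V: "finite V" "t \<le> card V" for E :: "'b set set" and V
  proof -
    have "card {..<t} \<le> card V"
      using V(2) by simp
    then obtain f where f: "f ` {..<t} \<subseteq> V" "inj_on f {..<t}"
      using card_le_inj[OF _ V(1)] by blast
    then show ?thesis
      unfolding packing_def by (intro exI[of _ "\<lambda>i. {f i}"]) (auto simp: indep_def inj_on_def)
  qed
  then show ?case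
    by (intro exI[of _ 0]) simp
next
  case (Suc M)
  \<comment> \<open>\<open>C\<close> vertices are lost to a maximal packing. The new blue cliques have \<open>D - 1\<close> vertices in
    total before they are extended. \<open>B\<close> is a size of \<open>P\<close> that suffices both for extending
    \<open>t\<close> blue cliques and for hosting the neighbours of at most \<open>C + 1\<close> vertices of degree at most 2.\<close>
  define C where "C = t * Suc (Suc M)"
  define D where "D = t * Suc M + 1"
  define B where "B = D * t + 4 * (C + 1)"
  obtain n1 where n1: "\<And>(G :: 'a sgraph) (E :: 'b set set) V. sparse k G \<Longrightarrow> n1 \<le> card (verts G) \<Longrightarrow>
      finite V \<Longrightarrow> (card (verts G) - 1) * M + t \<le> card V \<Longrightarrow> \<not> embeds G E V \<Longrightarrow> packing t (Suc M) E V"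
    using Suc by metis
  obtain n2 where n2: "\<And>(G :: 'a sgraph) (E :: 'b set set) U. sparse k G \<Longrightarrow> n2 \<le> card (verts G) \<Longrightarrow>
      finite U \<Longrightarrow> indep_free (Suc (Suc M)) E U \<Longrightarrow> \<not> embeds G E U \<Longrightarrow>
      (card (verts G) - 1) * Suc M \<le> card U + C \<Longrightarrow>
      \<exists>Q\<subseteq>U. clique Q E \<and> card (verts G) - 1 \<le> card Q + C"
    using large_red_clique[of k M C] by metis
  define T where "T = B * D ^ (C + 1)"
  define n0 where "n0 = n1 + n2 + (10 * (C + 1) + 2 * k + 2) + (T + C + 1)"
  have "packing t (Suc (Suc M)) E V"
    if G: "sparse k G" "n0 \<le> card (verts G)" and V: "finite V" "(card (verts G) - 1) * Suc M + t \<le> card V"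
      and no_copy: "\<not> embeds G E V"
    for G :: "'a sgraph" and E :: "'b set set" and V
  proof (cases "packing t (Suc (Suc M)) E V")
    case False
    have simple: "simple_graph G"
      using G(1) by (simp add: sparse_def)
    obtain U where U: "U \<subseteq> V" "card V \<le> card U + C" "indep_free (Suc (Suc M)) E U"
      using greedy_packing[OF V(1), of t "Suc (Suc M)" E] False unfolding C_def by blast
    have "\<not> embeds G E U"
      using embeds_mono U(1) no_copy by blast
    moreover have "(card (verts G) - 1) * Suc M \<le> card U + C"
      using U(2) V(2) by linarith
    moreover have "finite U"
      using U(1) V(1) finite_subset by blast
    ultimately obtain Q where Q: "Q \<subseteq> U" "clique Q E" "card (verts G) - 1 \<le> card Q + C"
      using n2[OF G(1) _ _ U(3)] G(2) unfolding n0_def by auto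
    have QV: "Q \<subseteq> V" "finite Q"
      using Q(1) U(1) V(1) by (auto intro: finite_subset[of Q V])
    have "card Q < card (verts G)"
    proof (rule ccontr)
      assume "\<not> ?thesis"
      then have "embeds G E Q"
        using embeds_in_clique[OF simple Q(2) QV(2)] by simp
      then show False
        using embeds_mono QV(1) no_copy by blast
    qed
    \<comment> \<open>the number of vertices that \<open>Q\<close> lacks to host \<open>G\<close>\<close>
    define s where "s = card (verts G) - card Q"
    have s: "s \<le> C + 1" "0 < s" "card (verts G) = card Q + s"
      using Q(3) \<open>card Q < card (verts G)\<close> unfolding s_def by linarith+
    have P_large: "B \<le> card P" if "card Q \<le> card P * D ^ a" "a \<le> s" for P :: "'b set" and a
    proof -
      have "T \<le> card Q"
        using Q(3) G(2) unfolding n0_def by linarith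
      also note that(1)
      also have "card P * D ^ a \<le> card P * D ^ (C + 1)"
        using that(2) s(1) by (intro mult_left_mono power_increasing) (simp_all add: D_def)
      finally show ?thesis
        unfolding T_def by (rule mult_right_le_imp_le) (simp add: D_def)
    qed
    have stop: "card A \<noteq> s" if A: "A \<subseteq> V - Q \<and> P \<subseteq> Q \<and> card Q \<le> card P * D ^ card A \<and>
        (\<forall>a\<in>A. \<forall>p\<in>P. {a, p} \<in> E)" for A P
    proof
      assume card_A: "card A = s"
      have "10 * s + 2 * k + 2 \<le> card (verts G)"
        using G(2) s(1) unfolding n0_def by simp
      then obtain I where I: "I \<subseteq> verts G" "card I = s" "I \<inter> neighbours G I = {}"
        "card (neighbours G I) \<le> 4 * s"
        using low_degree_independent_set[OF G(1)] by blast
      have "B \<le> card P"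
        using A card_A by (intro P_large[of P "card A"]) simp_all
      then have "card (neighbours G I) \<le> card P"
        using I(4) s(1) unfolding B_def by simp
      moreover have "finite A"
        using A V(1) by (meson finite_Diff finite_subset)
      ultimately have "embeds G E (Q \<union> A)"
        using A card_A I s(3)
        by (intro embeds_in_clique_with_absorbed[OF simple I(1,3) QV(2) Q(2), of P A]) auto
      moreover have "Q \<union> A \<subseteq> V"
        using A QV(1) by blast
      ultimately show False
        using embeds_mono no_copy by blast
    qed
    obtain A P where state: "A \<subseteq> V - Q \<and> P \<subseteq> Q \<and> card Q \<le> card P * D ^ card A \<and>
        (\<forall>a\<in>A. \<forall>p\<in>P. {a, p} \<in> E)" and "card A < s"
      and few: "\<forall>v\<in>V - Q - A. D * card {p \<in> P. {v, p} \<in> E} < card P"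
      by (rule absorb_maximal[where D = D and E = E and s = s, OF V(1) QV(1)])
        (rule stop, assumption, (rule that; assumption))
    then have A: "A \<subseteq> V - Q" "P \<subseteq> Q" "card Q \<le> card P * D ^ card A" "card A < s"
      by simp_all
    define W where "W = V - Q - A"
    have W: "W \<subseteq> V" "finite W" "P \<inter> W = {}"
      using V(1) A(2) unfolding W_def by auto
    have "finite P" "finite A"
      using A(1,2) QV(2) V(1) by (meson finite_Diff finite_subset)+
    have "card V \<le> card W + card (Q \<union> A)"
      using diff_card_le_card_Diff[of "Q \<union> A" V] QV(2) \<open>finite A\<close> unfolding W_def
      by (simp add: Diff_Un[symmetric] set_diff_eq Int_def)
    also have "card (Q \<union> A) \<le> card (verts G) - 1"
      using card_Un_le[of Q A] A(4) s(3) by linarith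
    finally have "(card (verts G) - 1) * M + t \<le> card W"
      using V(2) by simp
    moreover have "\<not> embeds G E W"
      using embeds_mono W(1) no_copy by blast
    moreover have "n1 \<le> card (verts G)"
      using G(2) unfolding n0_def by linarith
    ultimately have pack: "packing t (Suc M) E W"
      using n1 G(1) W(2) by blast
    have few': "(t * Suc M + 1) * card {p \<in> P. {v, p} \<in> E} \<le> card P" if "v \<in> W" for v
      using few that unfolding W_def[symmetric] D_def by (intro less_imp_le) blast
    have large: "(t * Suc M + 1) * t \<le> card P"
      using P_large[OF A(3)] A(4) unfolding B_def D_def[symmetric] by simp
    have "packing t (Suc (Suc M)) E (P \<union> W)"
      using packing_extend[OF pack \<open>finite P\<close> W(3) few' large W(2)] .
    moreover have "P \<union> W \<subseteq> V"
      using W(1) A(2) QV(1) by blast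
    ultimately show ?thesis
      by (rule packing_mono)
  qed
  then show ?case
    by (intro exI[of _ n0]) blast
qed

section \<open>Disjoint copies of a complete graph\<close>

lemma disjoint_copies_edge_iff:
  "{x, y} \<in> edges (disjoint_copies t (complete_graph m)) \<longleftrightarrow>
     (\<exists>i<t. \<exists>a<m. \<exists>b<m. a \<noteq> b \<and> x = (i, a) \<and> y = (i, b))"
proof
  assume "{x, y} \<in> edges (disjoint_copies t (complete_graph m))"
  then obtain i e where i: "i < t" "e \<in> [{..<m}]\<^bsup>2\<^esup>" "{x, y} = Pair i ` e"
    unfolding disjoint_copies_def complete_graph_def by auto
  obtain a b where ab: "e = {a, b}" "a \<noteq> b" "a < m" "b < m"
    using i(2) by (elim nsets2_E) auto
  then have "{x, y} = {(i, a), (i, b)}"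
    using i(3) by simp
  then have "x = (i, a) \<and> y = (i, b) \<or> x = (i, b) \<and> y = (i, a)"
    by (simp add: doubleton_eq_iff)
  then show "\<exists>i<t. \<exists>a<m. \<exists>b<m. a \<noteq> b \<and> x = (i, a) \<and> y = (i, b)"
    using i(1) ab by metis
next
  assume "\<exists>i<t. \<exists>a<m. \<exists>b<m. a \<noteq> b \<and> x = (i, a) \<and> y = (i, b)"
  then obtain i a b where ab: "i < t" "a < m" "b < m" "a \<noteq> b" "x = (i, a)" "y = (i, b)"
    by blast
  then have "{a, b} \<in> [{..<m}]\<^bsup>2\<^esup>" "{x, y} = Pair i ` {a, b}"
    by simp_all
  then have "{x, y} \<in> (\<lambda>e. Pair i ` e) ` [{..<m}]\<^bsup>2\<^esup>"
    by (metis imageI)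
  then show "{x, y} \<in> edges (disjoint_copies t (complete_graph m))"
    using ab(1) unfolding disjoint_copies_def complete_graph_def sgraph.sel by blast
qed

lemma embeds_disjoint_copies_if_packing:
  assumes K: "packing t m E V" and V: "finite V" and F: "\<And>e. e \<notin> E \<Longrightarrow> e \<in> F"
  shows "embeds (disjoint_copies t (complete_graph m)) F V"
proof -
  obtain K where K: "\<forall>i<t. K i \<subseteq> V \<and> card (K i) = m \<and> indep (K i) E"
    and disj: "\<forall>i<t. \<forall>j<t. i \<noteq> j \<longrightarrow> K i \<inter> K j = {}"
    using K unfolding packing_def by blast
  have "\<exists>h. bij_betw h {..<m} (K i)" if "i < t" for i
    using ex_bij_betw_nat_finite[of "K i"] K V finite_subset that
    by (metis atLeast0LessThan)
  then obtain h where h: "\<And>i. i < t \<Longrightarrow> bij_betw (h i) {..<m} (K i)"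
    by metis
  have hK: "h i a \<in> K i" if "i < t" "a < m" for i a
    using h[OF that(1)] that(2) by (auto dest: bij_betwE)
  have h_inj: "a = b" if "i < t" "a < m" "b < m" "h i a = h i b" for i a b
    using h[OF that(1)] that(2-) by (auto simp: bij_betw_def dest: inj_onD)
  let ?f = "\<lambda>(i, a). h i a"
  have "inj_on ?f ({..<t} \<times> {..<m})"
  proof (rule inj_onI)
    fix x y
    assume xy: "x \<in> {..<t} \<times> {..<m}" "y \<in> {..<t} \<times> {..<m}" "?f x = ?f y"
    obtain i a j b where ij: "x = (i, a)" "y = (j, b)"
      by (cases x, cases y)
    then have "i = j"
      using xy hK disj by fastforce
    then show "x = y"
      using xy ij h_inj[of i a b] by simp
  qed
  moreover have "?f ` ({..<t} \<times> {..<m}) \<subseteq> V"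
    using hK K by fastforce
  moreover have "{?f x, ?f y} \<in> F" if "{x, y} \<in> edges (disjoint_copies t (complete_graph m))" for x y
  proof -
    obtain i a b where ab: "i < t" "a < m" "b < m" "a \<noteq> b" "x = (i, a)" "y = (i, b)"
      using \<open>{x, y} \<in> edges (disjoint_copies t (complete_graph m))\<close> unfolding disjoint_copies_edge_iff by blast
    then have "{h i a, h i b} \<notin> E"
      using K hK h_inj unfolding indep_def by metis
    then show ?thesis
      using ab(5,6) F by simp
  qed
  ultimately show ?thesis
    unfolding embeds_def embedding_def
    by (intro exI[of _ ?f]) (simp add: disjoint_copies_def complete_graph_def)
qed

section \<open>The lower bound\<close>

text \<open>Colour an edge red if both ends lie in the same block \<open>{q * s..<q * s + s}\<close>. A red connected graph
has at most \<open>s\<close> vertices. There are only \<open>m\<close> blocks, so a blue \<open>K\<^sub>m\<close> meets all of them, including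
the last one, which has fewer than \<open>t\<close> vertices below \<open>N\<close>.\<close>
lemma not_arrows:
  fixes G :: "'a sgraph"
  assumes G: "simple_graph G" "connected_graph G" and s: "card (verts G) = Suc s"
    and m: "1 \<le> m" and t: "1 \<le> t" "t \<le> s" and N: "N < s * (m - 1) + t"
  shows "\<not> arrows N G (disjoint_copies t (complete_graph m))"
proof -
  define c where "c e = (if \<exists>q. \<forall>x\<in>e. x div s = q then Red else Blue)" for e :: "nat set"
  have "\<not> embeds G {e. c e = Red} {..<N}"
  proof
    assume "embeds G {e. c e = Red} {..<N}"
    then obtain f where f: "inj_on f (verts G)" "\<forall>x y. {x, y} \<in> edges G \<longrightarrow> c {f x, f y} = Red"
      unfolding embeds_def embedding_def by auto
    obtain v where v: "v \<in> verts G"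
      using G(2) unfolding connected_graph_def by blast
    have "f w div s = f v div s" if "(v, w) \<in> {(x, y). {x, y} \<in> edges G}\<^sup>*" for w
      using that
    proof (induction rule: rtrancl_induct)
      case (step w z)
      then have "c {f w, f z} = Red"
        using f(2) by simp
      then show ?case
        using step.IH by (auto simp: c_def split: if_splits)
    qed simp
    then have "f w div s = f v div s" if "w \<in> verts G" for w
      using G(2) v that unfolding connected_graph_def by blast
    then have "f w \<in> {f v div s * s..<f v div s * s + s}" if "w \<in> verts G" for w
    proof -
      have "f v div s * s + f w mod s = f w"
        using \<open>\<And>w. w \<in> verts G \<Longrightarrow> f w div s = f v div s\<close>[OF that] by (metis div_mult_mod_eq)
      moreover have "f w mod s < s"
        using t by simp
      ultimately show ?thesis
        by (simp only: atLeastLessThan_iff) linarith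
    qed
    then have "f ` verts G \<subseteq> {f v div s * s..<f v div s * s + s}"
      by blast
    then have "card (f ` verts G) \<le> card {f v div s * s..<f v div s * s + s}"
      by (intro card_mono) simp_all
    then show False
      using card_image[OF f(1)] s by simp
  qed
  moreover have "\<not> embeds (disjoint_copies t (complete_graph m)) {e. c e = Blue} {..<N}"
  proof
    assume "embeds (disjoint_copies t (complete_graph m)) {e. c e = Blue} {..<N}"
    then obtain f where f: "inj_on f ({..<t} \<times> {..<m})" "f ` ({..<t} \<times> {..<m}) \<subseteq> {..<N}"
      "\<forall>x y. {x, y} \<in> edges (disjoint_copies t (complete_graph m)) \<longrightarrow> c {f x, f y} = Blue"
      unfolding embeds_def embedding_def by (auto simp: disjoint_copies_def complete_graph_def)
    \<comment> \<open>the vertices of one blue clique lie in distinct blocks, so they fill all \<open>m\<close> blocks\<close>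
    have "\<exists>a<m. f (i, a) div s = m - 1" if i: "i < t" for i
    proof -
      let ?g = "\<lambda>a. f (i, a) div s"
      have "?g ` {..<m} \<subseteq> {..<m}"
      proof
        fix q
        assume "q \<in> ?g ` {..<m}"
        then obtain a where a: "a < m" "q = f (i, a) div s"
          by blast
        then have "f (i, a) < s * (m - 1) + s"
          using f(2) i N t by fastforce
        also have "\<dots> = m * s"
          using m by (cases m) simp_all
        finally show "q \<in> {..<m}"
          using a(2) by (simp add: less_mult_imp_div_less)
      qed
      moreover have "inj_on ?g {..<m}"
      proof (rule inj_onI)
        fix a b
        assume ab: "a \<in> {..<m}" "b \<in> {..<m}" "?g a = ?g b"
        show "a = b"
        proof (rule ccontr)
          assume "a \<noteq> b"
          then have "c {f (i, a), f (i, b)} = Blue"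
            using f(3) i ab unfolding disjoint_copies_edge_iff by auto
          then show False
            using ab(3) by (auto simp: c_def split: if_splits)
        qed
      qed
      ultimately have "?g ` {..<m} = {..<m}"
        by (intro endo_inj_surj) simp_all
      moreover have "m - 1 \<in> {..<m}"
        using m by simp
      ultimately show ?thesis
        by (metis (no_types, lifting) imageE lessThan_iff)
    qed
    then obtain a where a: "\<And>i. i < t \<Longrightarrow> a i < m" "\<And>i. i < t \<Longrightarrow> f (i, a i) div s = m - 1"
      by metis
    have "inj_on (\<lambda>i. f (i, a i)) {..<t}"
    proof (rule inj_onI)
      fix i j
      assume "i \<in> {..<t}" "j \<in> {..<t}" "f (i, a i) = f (j, a j)"
      then show "i = j"
        using inj_onD[OF f(1), of "(i, a i)" "(j, a j)"] a(1) by simp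
    qed
    moreover have "(\<lambda>i. f (i, a i)) ` {..<t} \<subseteq> {s * (m - 1)..<N}"
    proof
      fix x
      assume "x \<in> (\<lambda>i. f (i, a i)) ` {..<t}"
      then obtain i where i: "i < t" "x = f (i, a i)"
        by blast
      have "s * (x div s) \<le> x"
        by simp
      then show "x \<in> {s * (m - 1)..<N}"
        using a[OF i(1)] f(2) i by auto
    qed
    ultimately have "t \<le> card {s * (m - 1)..<N}"
      using card_inj_on_le[of "\<lambda>i. f (i, a i)" "{..<t}" "{s * (m - 1)..<N}"] by simp
    then show False
      using N t(1) by simp
  qed
  moreover have "simple_graph (disjoint_copies t (complete_graph m))"
    by (intro simple_graph_disjoint_copies simple_graph_complete_graph)
  ultimately have "\<not> has_copy (colour_graph N c Red) G"
    "\<not> has_copy (colour_graph N c Blue) (disjoint_copies t (complete_graph m))"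
    by (simp_all add: has_copy_colour_graph_iff G(1))
  then show ?thesis
    unfolding arrows_def by blast
qed

section \<open>The Ramsey number\<close>

theorem corollary1:
  fixes k m t :: nat
  assumes "k \<ge> 1" and "m \<ge> 1" and "t \<ge> 1"
  shows "\<exists>n0. \<forall>n\<ge>n0. \<forall>G :: 'a sgraph.
           simple_graph G \<and> connected_graph G \<and>
           card (verts G) = n \<and> card (edges G) = n + k - 2 \<longrightarrow>
           ramsey_number G (disjoint_copies t (complete_graph m)) = (n - 1) * (m - 1) + t"
proof -
  let ?H = "disjoint_copies t (complete_graph m)"
  obtain n1 where n1: "\<And>(G :: 'a sgraph) (E :: nat set set) V. sparse k G \<Longrightarrow> n1 \<le> card (verts G) \<Longrightarrow>
      finite V \<Longrightarrow> (card (verts G) - 1) * (m - 1) + t \<le> card V \<Longrightarrow> \<not> embeds G E V \<Longrightarrow>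
      packing t (Suc (m - 1)) E V"
    using packing_if_no_copy[of k "m - 1" t] by metis
  have "ramsey_number G ?H = (n - 1) * (m - 1) + t"
    if n: "n1 + t + 1 \<le> n" and G: "simple_graph G" "connected_graph G"
      "card (verts G) = n" "card (edges G) = n + k - 2" for n and G :: "'a sgraph"
  proof -
    have H: "simple_graph ?H"
      by (intro simple_graph_disjoint_copies simple_graph_complete_graph)
    have "sparse k G"
      using G by (simp add: sparse_def)
    have "arrows ((n - 1) * (m - 1) + t) G ?H"
      unfolding arrows_def
    proof
      fix c
      let ?N = "(n - 1) * (m - 1) + t"
      show "has_copy (colour_graph ?N c Red) G \<or> has_copy (colour_graph ?N c Blue) ?H"
      proof (cases "embeds G {e. c e = Red} {..<?N}")
        case True
        then show ?thesis
          using has_copy_colour_graph_iff[OF G(1)] by blast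
      next
        case False
        then have "packing t m {e. c e = Red} {..<?N}"
          using n1[OF \<open>sparse k G\<close>, of "{..<?N}"] n G(3) assms(2) by simp
        then have "embeds ?H {e. c e = Blue} {..<?N}"
          by (rule embeds_disjoint_copies_if_packing) (use colour.exhaust in auto)
        then show ?thesis
          using has_copy_colour_graph_iff[OF H] by blast
      qed
    qed
    moreover have "\<not> arrows N G ?H" if "N < (n - 1) * (m - 1) + t" for N
      using not_arrows[OF G(1,2) _ assms(2,3) _ that] G(3) n by simp
    ultimately show ?thesis
      unfolding ramsey_number_def using assms(3)
      by (intro Least_equality) (simp, metis not_less)
  qed
  then show ?thesis
    by (intro exI[of _ "n1 + t + 1"]) blast
qed

end
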